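(* Let $S=\mathcal{M}^0[G;I,\Lambda;P]$ be a countable Rees matrix semigroup such that $G$ is finite. Then $S$ is $\aleph_0$-categorical if and only if each connected Rees component of $S$ is $\aleph_0$-categorical and $S$ has only finitely many connected Rees components, up to isomorphism.
   Context: A countable structure is $\aleph_0$-categorical iff its automorphism group has finitely many orbits on $n$-tuples for each $n\ge1$. A Rees matrix semigroup $\mathcal{M}^0[G;I,\Lambda;P]$: $G$ a group, $I,\Lambda$ non-empty sets, $P=(p_{\lambda,i})$ a $\Lambda\times I$ matrix over $G\cup\{0\}$ with no row or column entirely zero; the semigroup is $(I\times G\times\Lambda)\cup\{0\}$ with $(i,g,\lambda)(j,h,\mu)=(i,gp_{\lambda,j}h,\mu)$ if $p_{\lambda,j}\neq0$ and $0$ otherwise, $0$ a zero. The induced bipartite graph $\Gamma(P)$ has left set $I$, right set $\Lambda$, and edges $\{i,\lambda\}$ with $p_{\lambda,i}\neq 0$. If the connected components of $\Gamma(P)$ have vertex sets $I_k\cup\Lambda_k$ ($k\in A$, $I_k\subseteq I$, $\Lambda_k\subseteq\Lambda$), the connected Rees components of $S$ are the subsemigroups $S_k=\{(i,g,\lambda): i\in I_k,g\in G,\lambda\in\Lambda_k\}\cup\{0\}=\mathcal{M}^0[G;I_k,\Lambda_k;P_k]$, where $P_k$ is the $\Lambda_k\times I_k$ submatrix of $P$. *)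

theory Defs
  imports "HOL-Algebra.Group" "HOL-Library.Countable_Set"
begin

text \<open>The Algebra library has no carrier-based semigroups; its \<open>monoid\<close> record would demand
  an identity element.\<close>

record 'a binary_structure = "'a partial_object" +
  op :: "'a \<Rightarrow> 'a \<Rightarrow> 'a"

definition semigroup_iso ::
  "('a, 'm) binary_structure_scheme \<Rightarrow> ('b, 'n) binary_structure_scheme \<Rightarrow> ('a \<Rightarrow> 'b) set" where
  "semigroup_iso S T =
     {f. bij_betw f (carrier S) (carrier T) \<and>
         (\<forall>x\<in>carrier S. \<forall>y\<in>carrier S. f (op S x y) = op T (f x) (f y))}"

definition isomorphic ::
  "('a, 'm) binary_structure_scheme \<Rightarrow> ('b, 'n) binary_structure_scheme \<Rightarrow> bool" where
  "isomorphic S T \<longleftrightarrow> semigroup_iso S T \<noteq> {}"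

definition tuples :: "('a, 'm) binary_structure_scheme \<Rightarrow> nat \<Rightarrow> 'a list set" where
  "tuples S n = {xs. length xs = n \<and> set xs \<subseteq> carrier S}"

definition same_orbit ::
  "('a, 'm) binary_structure_scheme \<Rightarrow> nat \<Rightarrow> ('a list \<times> 'a list) set" where
  "same_orbit S n =
     {(xs, ys). xs \<in> tuples S n \<and> ys \<in> tuples S n \<and> (\<exists>f\<in>semigroup_iso S S. ys = map f xs)}"

text \<open>The Ryll-Nardzewski form, for countable structures: the automorphism group has finitely many
  orbits on \<open>n\<close>-tuples. Countable includes finite.\<close>

definition aleph0_categorical :: "('a, 'm) binary_structure_scheme \<Rightarrow> bool" where
  "aleph0_categorical S \<longleftrightarrow>
     countable (carrier S) \<and> (\<forall>n\<ge>1. finite (tuples S n // same_orbit S n))"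

text \<open>The entry \<open>p\<^bsub>\<lambda>,i\<^esub>\<close> is \<open>P \<lambda> i\<close>, and \<open>None\<close> is the zero adjoined to \<open>G\<close>. Only the values
  of \<open>P\<close> on \<open>\<Lambda> \<times> I\<close> matter.\<close>

locale rees_matrix = group G
  for G :: "('g, 'm) monoid_scheme" (structure) +
  fixes I :: "'i set" and \<Lambda> :: "'l set" and P :: "'l \<Rightarrow> 'i \<Rightarrow> 'g option"
  assumes I_nonempty: "I \<noteq> {}"
    and \<Lambda>_nonempty: "\<Lambda> \<noteq> {}"
    and entries: "\<And>l i. l \<in> \<Lambda> \<Longrightarrow> i \<in> I \<Longrightarrow> P l i \<in> insert None (Some ` carrier G)"
    and no_zero_row: "\<And>l. l \<in> \<Lambda> \<Longrightarrow> \<exists>i\<in>I. P l i \<noteq> None"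
    and no_zero_column: "\<And>i. i \<in> I \<Longrightarrow> \<exists>l\<in>\<Lambda>. P l i \<noteq> None"

fun rees_mult ::
  "('g, 'm) monoid_scheme \<Rightarrow> ('l \<Rightarrow> 'i \<Rightarrow> 'g option) \<Rightarrow>
   ('i \<times> 'g \<times> 'l) option \<Rightarrow> ('i \<times> 'g \<times> 'l) option \<Rightarrow> ('i \<times> 'g \<times> 'l) option" where
  "rees_mult G P (Some (i, g, l)) (Some (j, h, k)) =
     (case P l j of
        None \<Rightarrow> None
      | Some p \<Rightarrow> Some (i, g \<otimes>\<^bsub>G\<^esub> p \<otimes>\<^bsub>G\<^esub> h, k))"
| "rees_mult G P None y = None"
| "rees_mult G P x None = None"

text \<open>Here \<open>None\<close> is the zero of the semigroup.\<close>

definition rees_semigroup ::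
  "('g, 'm) monoid_scheme \<Rightarrow> 'i set \<Rightarrow> 'l set \<Rightarrow> ('l \<Rightarrow> 'i \<Rightarrow> 'g option) \<Rightarrow>
   ('i \<times> 'g \<times> 'l) option binary_structure" where
  "rees_semigroup G I \<Lambda> P =
     \<lparr>carrier = insert None (Some ` (I \<times> carrier G \<times> \<Lambda>)), op = rees_mult G P\<rparr>"

text \<open>The vertex set of the bipartite graph is the disjoint union \<open>I <+> \<Lambda>\<close>; each undirected
  edge is represented by both of its orientations.\<close>

definition rees_edges ::
  "'i set \<Rightarrow> 'l set \<Rightarrow> ('l \<Rightarrow> 'i \<Rightarrow> 'g option) \<Rightarrow> (('i + 'l) \<times> ('i + 'l)) set" where
  "rees_edges I \<Lambda> P =
     (let E = {(Inl i, Inr l) | i l. i \<in> I \<and> l \<in> \<Lambda> \<and> P l i \<noteq> None} in E \<union> E\<inverse>)"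

definition rees_graph_components ::
  "'i set \<Rightarrow> 'l set \<Rightarrow> ('l \<Rightarrow> 'i \<Rightarrow> 'g option) \<Rightarrow> ('i + 'l) set set" where
  "rees_graph_components I \<Lambda> P =
     (I <+> \<Lambda>) // {(u, v). u \<in> I <+> \<Lambda> \<and> v \<in> I <+> \<Lambda> \<and> (u, v) \<in> (rees_edges I \<Lambda> P)\<^sup>*}"

text \<open>For a component \<open>C\<close> with vertex set \<open>I\<^sub>k \<union> \<Lambda>\<^sub>k\<close>, the sets \<open>I\<^sub>k\<close> and \<open>\<Lambda>\<^sub>k\<close> are \<open>Inl -` C\<close> and
  \<open>Inr -` C\<close>.\<close>

definition rees_component ::
  "('g, 'm) monoid_scheme \<Rightarrow> 'i set \<Rightarrow> 'l set \<Rightarrow> ('l \<Rightarrow> 'i \<Rightarrow> 'g option) \<Rightarrow>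
   ('i + 'l) set \<Rightarrow> ('i \<times> 'g \<times> 'l) option binary_structure" where
  "rees_component G I \<Lambda> P C =
     (rees_semigroup G I \<Lambda> P)
       \<lparr>carrier := insert None {Some (i, g, l) | i g l. Inl i \<in> C \<and> g \<in> carrier G \<and> Inr l \<in> C}\<rparr>"

lemma rees_component_eq_rees_semigroup:
  "rees_component G I \<Lambda> P C = rees_semigroup G (Inl -` C) (Inr -` C) P"
  by (auto simp: rees_component_def rees_semigroup_def)

definition connected_rees_components ::
  "('g, 'm) monoid_scheme \<Rightarrow> 'i set \<Rightarrow> 'l set \<Rightarrow> ('l \<Rightarrow> 'i \<Rightarrow> 'g option) \<Rightarrow>
   ('i \<times> 'g \<times> 'l) option binary_structure set" where
  "connected_rees_components G I \<Lambda> P = rees_component G I \<Lambda> P ` rees_graph_components I \<Lambda> P"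

definition finitely_many_up_to_iso :: "'a binary_structure set \<Rightarrow> bool" where
  "finitely_many_up_to_iso K \<longleftrightarrow>
     finite (K // {(S, T). S \<in> K \<and> T \<in> K \<and> isomorphic S T})"

end

theory Submission
  imports Defs "HOL-Combinatorics.Transposition"
begin

text \<open>An automorphism of \<open>S\<close> permutes the connected components of \<open>\<Gamma>(P)\<close>, so if it moves a nonzero
  element of \<open>S\<^sub>k\<close> into \<open>S\<^sub>m\<close> it restricts to an isomorphism from \<open>S\<^sub>k\<close> to \<open>S\<^sub>m\<close>. Adding such an
  element to a tuple bounds the orbits of \<open>S\<^sub>k\<close> and the isomorphism types by the orbits of \<open>S\<close>.

  Conversely, \<open>S\<close> is not the union of its components, and isomorphisms of components glue to an
  automorphism of \<open>S\<close> only if they induce the same automorphism of \<open>G\<close>. Since \<open>G\<close> is finite, all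
  elements \<open>(i, g, \<lambda>)\<close>, \<open>g \<in> G\<close>, for one edge \<open>{i, \<lambda>}\<close> of a component can be appended to a tuple; an
  isomorphism respecting them acts by \<open>(j, g, \<mu>) \<mapsto> (j\<psi>, u\<^sub>j g v\<^sub>\<mu>, \<mu>\<chi>)\<close> with no automorphism of \<open>G\<close>
  involved. The orbits of these enlarged tuples, over representatives of the finitely many isomorphism
  types, give a finite invariant of tuples of \<open>S\<close>. Two tuples with equal invariants are related by
  such isomorphisms on the finitely many components they meet, and the induced type-preserving
  partial injection of components extends to a permutation of all components.\<close>

section \<open>Isomorphisms of binary structures and the orbit relation on tuples\<close>

lemma semigroup_iso_closed:
  "f \<in> semigroup_iso S T \<Longrightarrow> x \<in> carrier S \<Longrightarrow> f x \<in> carrier T"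
  by (auto simp: semigroup_iso_def bij_betw_def)

lemma semigroup_iso_op:
  "f \<in> semigroup_iso S T \<Longrightarrow> x \<in> carrier S \<Longrightarrow> y \<in> carrier S \<Longrightarrow> f (op S x y) = op T (f x) (f y)"
  by (auto simp: semigroup_iso_def)

lemma semigroup_iso_bij:
  "f \<in> semigroup_iso S T \<Longrightarrow> bij_betw f (carrier S) (carrier T)"
  by (auto simp: semigroup_iso_def)

lemma semigroup_iso_id: "id \<in> semigroup_iso S S"
  by (auto simp: semigroup_iso_def)

lemma semigroup_iso_comp:
  assumes "f \<in> semigroup_iso S T" "g \<in> semigroup_iso T U"
  shows "g \<circ> f \<in> semigroup_iso S U"
  using assms by (auto simp: semigroup_iso_def bij_betw_apply intro: bij_betw_trans)

text \<open>A \<open>binary_structure\<close> need not be closed under \<open>op\<close>. Closure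
  puts \<open>op S x y\<close> into the carrier, where \<open>inv_into\<close> cancels
  \<open>f\<close>.\<close>

lemma semigroup_iso_inv_into:
  assumes f: "f \<in> semigroup_iso S T"
    and closed: "\<And>x y. x \<in> carrier S \<Longrightarrow> y \<in> carrier S \<Longrightarrow> op S x y \<in> carrier S"
  shows "inv_into (carrier S) f \<in> semigroup_iso T S"
proof -
  let ?g = "inv_into (carrier S) f"
  have b: "bij_betw f (carrier S) (carrier T)"
    using f by (rule semigroup_iso_bij)
  have "?g (op T x y) = op S (?g x) (?g y)" if "x \<in> carrier T" "y \<in> carrier T" for x y
  proof -
    have g: "?g x \<in> carrier S" "?g y \<in> carrier S"
      using b that by (auto simp: bij_betw_def inv_into_into)
    have "op T x y = f (op S (?g x) (?g y))"
      using semigroup_iso_op[OF f g] b that by (simp add: bij_betw_inv_into_right)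
    then show ?thesis
      using b closed[OF g] by (simp add: bij_betw_inv_into_left)
  qed
  then show ?thesis
    using bij_betw_inv_into[OF b] by (simp add: semigroup_iso_def)
qed

lemma same_orbit_refl: "xs \<in> tuples S n \<Longrightarrow> (xs, xs) \<in> same_orbit S n"
  using semigroup_iso_id[of S] by (force simp: same_orbit_def)

lemma equiv_same_orbit:
  assumes closed: "\<And>x y. x \<in> carrier S \<Longrightarrow> y \<in> carrier S \<Longrightarrow> op S x y \<in> carrier S"
  shows "equiv (tuples S n) (same_orbit S n)"
proof (rule equivI)
  show "same_orbit S n \<subseteq> tuples S n \<times> tuples S n"
    by (auto simp: same_orbit_def)
  show "refl_on (tuples S n) (same_orbit S n)"
    by (auto simp: refl_on_def same_orbit_refl)
  show "sym (same_orbit S n)"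
  proof (rule symI)
    fix xs ys assume "(xs, ys) \<in> same_orbit S n"
    then obtain f where f: "f \<in> semigroup_iso S S" "ys = map f xs"
      and t: "xs \<in> tuples S n" "ys \<in> tuples S n"
      by (auto simp: same_orbit_def)
    have "xs = map (inv_into (carrier S) f) ys"
      using f t semigroup_iso_bij[OF f(1)]
      by (auto simp: tuples_def bij_betw_inv_into_left subset_iff intro!: map_idI[symmetric])
    then show "(ys, xs) \<in> same_orbit S n"
      using t semigroup_iso_inv_into[OF f(1) closed] by (auto simp: same_orbit_def)
  qed
  show "trans (same_orbit S n)"
  proof (rule transI)
    fix xs ys zs assume "(xs, ys) \<in> same_orbit S n" "(ys, zs) \<in> same_orbit S n"
    then obtain f g where "f \<in> semigroup_iso S S" "ys = map f xs" "g \<in> semigroup_iso S S" "zs = map g ys"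
      and t: "xs \<in> tuples S n" "zs \<in> tuples S n"
      by (auto simp: same_orbit_def)
    then have "g \<circ> f \<in> semigroup_iso S S" "zs = map (g \<circ> f) xs"
      using semigroup_iso_comp by auto
    with t show "(xs, zs) \<in> same_orbit S n"
      unfolding same_orbit_def by blast
  qed
qed

lemma equiv_isomorphic:
  assumes closed: "\<And>S x y. S \<in> K \<Longrightarrow> x \<in> carrier S \<Longrightarrow> y \<in> carrier S \<Longrightarrow> op S x y \<in> carrier S"
  shows "equiv K {(S, T). S \<in> K \<and> T \<in> K \<and> isomorphic S T}"
proof (rule equivI)
  show "refl_on K {(S, T). S \<in> K \<and> T \<in> K \<and> isomorphic S T}"
    using semigroup_iso_id by (fastforce simp: refl_on_def isomorphic_def)
  show "sym {(S, T). S \<in> K \<and> T \<in> K \<and> isomorphic S T}"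
    using semigroup_iso_inv_into closed by (fastforce simp: sym_def isomorphic_def)
  show "trans {(S, T). S \<in> K \<and> T \<in> K \<and> isomorphic S T}"
    using semigroup_iso_comp by (fastforce simp: trans_def isomorphic_def)
qed auto

section \<open>Counting classes by invariants, and extending finite injections\<close>

text \<open>Choosing one point in each fibre of \<open>h\<close> gives a map from the values of
  \<open>h\<close> onto the classes. Since \<open>h\<close> may vary within a class, invariants that
  depend on arbitrary choices are allowed.\<close>

lemma finite_quotient_by_invariant:
  assumes r: "equiv A r" and fin: "finite (h ` A)"
    and inv: "\<And>x y. x \<in> A \<Longrightarrow> y \<in> A \<Longrightarrow> h x = h y \<Longrightarrow> (x, y) \<in> r"
  shows "finite (A // r)"
proof -
  have "r `` {x} = r `` {SOME y. y \<in> A \<and> h y = h x}" if "x \<in> A" for x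
  proof -
    have "(SOME y. y \<in> A \<and> h y = h x) \<in> A \<and> h (SOME y. y \<in> A \<and> h y = h x) = h x"
      by (rule someI_ex) (use that in blast)
    then show ?thesis
      using inv[of x "SOME y. y \<in> A \<and> h y = h x"] that equiv_class_eq[OF r] by metis
  qed
  then have "A // r \<subseteq> (\<lambda>z. r `` {SOME y. y \<in> A \<and> h y = z}) ` h ` A"
    by (auto simp: quotient_def)
  then show ?thesis
    using fin finite_surj by blast
qed

lemma finite_orbit_classes:
  assumes "finite (A // r)"
  shows "finite ((\<lambda>x. r `` {x}) ` A)"
  using assms by (simp add: quotient_def UNION_singleton_eq_range)

text \<open>When \<open>a\<close> is added, the permutation found for \<open>A\<close> is followed
  by the transposition of \<open>p a\<close> and \<open>s a\<close>. These two points have the same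
  type under \<open>t\<close>, and the points \<open>p b = s b\<close> with \<open>b\<close> in
  \<open>A\<close> differ from both, so earlier values survive.\<close>

lemma extend_finite_injection:
  assumes "finite A" "A \<subseteq> K" "inj_on s A" "s ` A \<subseteq> K" "\<And>a. a \<in> A \<Longrightarrow> t (s a) = t a"
  shows "\<exists>p. bij_betw p K K \<and> (\<forall>a\<in>A. p a = s a) \<and> (\<forall>k\<in>K. t (p k) = t k)"
  using assms
proof (induction A)
  case empty
  then show ?case by (intro exI[of _ id]) (auto simp: bij_betw_def)
next
  case (insert a A)
  then obtain p where p: "bij_betw p K K" "\<forall>a\<in>A. p a = s a" "\<forall>k\<in>K. t (p k) = t k"
    by auto
  let ?q = "transpose (p a) (s a) \<circ> p"
  have K: "a \<in> K" "s a \<in> K" "p a \<in> K"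
    using insert.prems p(1) by (auto simp: bij_betw_apply)
  have "bij_betw (transpose (p a) (s a)) K K"
    using K by (simp add: bij_betw_transpose_iff)
  then have "bij_betw ?q K K"
    using p(1) by (rule bij_betw_trans[rotated])
  moreover have "?q b = s b" if b: "b \<in> insert a A" for b
  proof (cases "b = a")
    case False
    then have "p b \<noteq> p a" "s b \<noteq> s a"
      using b insert.prems insert.hyps K p(1) by (auto simp: bij_betw_def inj_on_def)
    then show ?thesis using False b p(2) by simp
  qed simp
  moreover have "t (?q k) = t k" if "k \<in> K" for k
  proof -
    have "t (s a) = t (p a)" using p(3) K insert.prems(4)[of a] by simp
    then have "t (transpose (p a) (s a) x) = t x" for x by (auto simp: transpose_def)
    then show ?thesis using that p(3) by simp
  qed
  ultimately show ?case by blast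
qed

lemma bij_betw_map_sum:
  assumes "bij_betw f A B" "bij_betw g C D"
  shows "bij_betw (map_sum f g) (A <+> C) (B <+> D)"
proof (rule bij_betw_imageI)
  show "inj_on (map_sum f g) (A <+> C)"
  proof (rule inj_onI)
    fix x y assume "x \<in> A <+> C" "y \<in> A <+> C" "map_sum f g x = map_sum f g y"
    then show "x = y"
      using assms by (cases x; cases y) (auto simp: bij_betw_def dest: inj_onD)
  qed
  have "map_sum f g ` (A <+> C) = f ` A <+> g ` C"
    by (simp add: Plus_def image_Un image_image)
  then show "map_sum f g ` (A <+> C) = B <+> D"
    using assms by (simp add: bij_betw_def)
qed

section \<open>Isomorphisms of Rees matrix semigroups in coordinates\<close>

text \<open>Indexing the matrix by vertices of the graph lets a single condition on pairs of
  vertices be restricted to a component and glued over all components.\<close>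

definition vertex_entry :: "('l \<Rightarrow> 'i \<Rightarrow> 'g option) \<Rightarrow> 'i + 'l \<Rightarrow> 'i + 'l \<Rightarrow> 'g option" where
  "vertex_entry P x y = (case (x, y) of (Inr l, Inl i) \<Rightarrow> P l i | _ \<Rightarrow> None)"

text \<open>The condition on the entries says that \<open>(i, g, \<lambda>) \<mapsto> (\<phi> i, w\<^sub>i g w\<^sub>\<lambda>, \<phi> \<lambda>)\<close> is multiplicative,
  that is, an isomorphism whose automorphism of \<open>G\<close> is trivial.\<close>

definition normalized_iso ::
  "('g, 'm) monoid_scheme \<Rightarrow> ('l \<Rightarrow> 'i \<Rightarrow> 'g option) \<Rightarrow> ('l \<Rightarrow> 'i \<Rightarrow> 'g option) \<Rightarrow>
   ('i + 'l) set \<Rightarrow> ('i + 'l) set \<Rightarrow> ('i + 'l \<Rightarrow> 'i + 'l) \<Rightarrow> ('i + 'l \<Rightarrow> 'g) \<Rightarrow> bool" where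
  "normalized_iso G P Q C D \<phi> w \<longleftrightarrow>
     bij_betw \<phi> C D \<and> (\<forall>x\<in>C. isl (\<phi> x) = isl x \<and> w x \<in> carrier G) \<and>
     (\<forall>x\<in>C. \<forall>y\<in>C. vertex_entry P x y =
        map_option (\<lambda>q. w x \<otimes>\<^bsub>G\<^esub> q \<otimes>\<^bsub>G\<^esub> w y) (vertex_entry Q (\<phi> x) (\<phi> y)))"

context rees_matrix
begin

lemma rees_closed:
  "x \<in> carrier (rees_semigroup G I \<Lambda> P) \<Longrightarrow> y \<in> carrier (rees_semigroup G I \<Lambda> P) \<Longrightarrow>
    op (rees_semigroup G I \<Lambda> P) x y \<in> carrier (rees_semigroup G I \<Lambda> P)"
  using entries by (fastforce simp: rees_semigroup_def image_iff split: option.splits)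

text \<open>If \<open>f z\<close> is zero, then zero times \<open>z\<close> is again zero, so
  \<open>f None\<close> equals \<open>f None\<close> times zero.\<close>

lemma iso_None:
  assumes f: "f \<in> semigroup_iso (rees_semigroup G I \<Lambda> P) (rees_semigroup G J M Q)"
  shows "f None = None"
proof -
  have "None \<in> f ` carrier (rees_semigroup G I \<Lambda> P)"
    using semigroup_iso_bij[OF f] by (auto simp: bij_betw_def rees_semigroup_def)
  then obtain z where z: "z \<in> carrier (rees_semigroup G I \<Lambda> P)" "f z = None" by force
  have "f (op (rees_semigroup G I \<Lambda> P) None z) = op (rees_semigroup G J M Q) (f None) (f z)"
    by (rule semigroup_iso_op[OF f _ z(1)]) (simp add: rees_semigroup_def)
  then show ?thesis
    using z(2) by (cases "f None") (auto simp: rees_semigroup_def)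
qed

lemma iso_Some:
  assumes f: "f \<in> semigroup_iso (rees_semigroup G I \<Lambda> P) (rees_semigroup G J M Q)"
    and m: "i \<in> I" "g \<in> carrier G" "l \<in> \<Lambda>"
  shows "\<exists>j h k. f (Some (i, g, l)) = Some (j, h, k) \<and> j \<in> J \<and> h \<in> carrier G \<and> k \<in> M"
proof -
  have "Some (i, g, l) \<in> carrier (rees_semigroup G I \<Lambda> P)" "None \<in> carrier (rees_semigroup G I \<Lambda> P)"
    using m by (auto simp: rees_semigroup_def)
  then have "f (Some (i, g, l)) \<noteq> f None" "f (Some (i, g, l)) \<in> carrier (rees_semigroup G J M Q)"
    using semigroup_iso_bij[OF f] unfolding bij_betw_def by (blast dest: inj_onD)+
  then have "f (Some (i, g, l)) \<noteq> None" "f (Some (i, g, l)) \<in> carrier (rees_semigroup G J M Q)"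
    by (simp_all add: iso_None[OF f])
  then show ?thesis by (auto simp: rees_semigroup_def)
qed

lemma iso_mult:
  assumes f: "f \<in> semigroup_iso (rees_semigroup G I \<Lambda> P) (rees_semigroup G J M Q)"
    and "i \<in> I" "g \<in> carrier G" "l \<in> \<Lambda>" "i' \<in> I" "g' \<in> carrier G" "l' \<in> \<Lambda>"
  shows "f (rees_mult G P (Some (i, g, l)) (Some (i', g', l'))) =
     rees_mult G Q (f (Some (i, g, l))) (f (Some (i', g', l')))"
  using semigroup_iso_op[OF f, of "Some (i, g, l)" "Some (i', g', l')"] assms(2-)
  by (auto simp: rees_semigroup_def)

lemma entry_closed: "l \<in> \<Lambda> \<Longrightarrow> i \<in> I \<Longrightarrow> P l i = Some p \<Longrightarrow> p \<in> carrier G"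
  using entries by force

text \<open>A nonzero product inherits its left index from the left factor and its right index from
  the right factor. Each \<open>(i, g, l)\<close> factors with left factor
  \<open>(i, \<one>, l0)\<close>, and also with right factor \<open>(i0, \<one>, l)\<close>, so the
  outer indices of its image depend on \<open>i\<close> and on \<open>l\<close> alone.\<close>

lemma iso_vertex_maps:
  assumes f: "f \<in> semigroup_iso (rees_semigroup G I \<Lambda> P) (rees_semigroup G J M Q)"
  obtains \<psi> \<chi> where "\<And>i. i \<in> I \<Longrightarrow> \<psi> i \<in> J" "\<And>l. l \<in> \<Lambda> \<Longrightarrow> \<chi> l \<in> M"
    and "\<And>i g l. i \<in> I \<Longrightarrow> g \<in> carrier G \<Longrightarrow> l \<in> \<Lambda> \<Longrightarrow>
        \<exists>h\<in>carrier G. f (Some (i, g, l)) = Some (\<psi> i, h, \<chi> l)"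
    and "\<And>i l. i \<in> I \<Longrightarrow> l \<in> \<Lambda> \<Longrightarrow> P l i \<noteq> None \<longleftrightarrow> Q (\<chi> l) (\<psi> i) \<noteq> None"
proof -
  obtain i0 l0 where 0: "i0 \<in> I" "l0 \<in> \<Lambda>" using I_nonempty \<Lambda>_nonempty by blast
  define \<psi> where "\<psi> i = fst (the (f (Some (i, \<one>, l0))))" for i
  define \<chi> where "\<chi> l = snd (snd (the (f (Some (i0, \<one>, l)))))" for l
  have left: "fst (the (f (Some (i, g, l)))) = \<psi> i"
    if m: "i \<in> I" "g \<in> carrier G" "l \<in> \<Lambda>" for i g l
  proof -
    obtain j p where j: "j \<in> I" "P l0 j = Some p" using no_zero_row[OF 0(2)] by auto
    have p: "p \<in> carrier G" using j entry_closed 0 by blast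
    let ?x = "Some (i, \<one>, l0)" and ?y = "Some (j, inv p \<otimes> g, l)"
    have "rees_mult G P ?x ?y = Some (i, g, l)"
      using j p m by (simp add: m_assoc[symmetric])
    moreover have "f (rees_mult G P ?x ?y) = rees_mult G Q (f ?x) (f ?y)"
      using m j 0 p by (intro iso_mult[OF f]) auto
    moreover obtain a b c where "f ?x = Some (a, b, c)"
      using iso_Some[OF f m(1) one_closed 0(2)] by blast
    moreover obtain a' b' c' where "f ?y = Some (a', b', c')"
      using iso_Some[OF f j(1) _ m(3), of "inv p \<otimes> g"] p m by blast
    moreover have "f (Some (i, g, l)) \<noteq> None" using iso_Some[OF f m] by auto
    ultimately show ?thesis by (auto simp: \<psi>_def split: option.splits)
  qed
  have right: "snd (snd (the (f (Some (i, g, l))))) = \<chi> l"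
    if m: "i \<in> I" "g \<in> carrier G" "l \<in> \<Lambda>" for i g l
  proof -
    obtain k p where k: "k \<in> \<Lambda>" "P k i0 = Some p" using no_zero_column[OF 0(1)] by auto
    have p: "p \<in> carrier G" using k entry_closed 0 by blast
    let ?x = "Some (i, g \<otimes> inv p, k)" and ?y = "Some (i0, \<one>, l)"
    have "rees_mult G P ?x ?y = Some (i, g, l)"
      using k p m by (simp add: m_assoc)
    moreover have "f (rees_mult G P ?x ?y) = rees_mult G Q (f ?x) (f ?y)"
      using m k 0 p by (intro iso_mult[OF f]) auto
    moreover obtain a b c where "f ?y = Some (a, b, c)"
      using iso_Some[OF f 0(1) one_closed m(3)] by blast
    moreover obtain a' b' c' where "f ?x = Some (a', b', c')"
      using iso_Some[OF f m(1) _ k(1), of "g \<otimes> inv p"] p m by blast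
    moreover have "f (Some (i, g, l)) \<noteq> None" using iso_Some[OF f m] by auto
    ultimately show ?thesis by (auto simp: \<chi>_def split: option.splits)
  qed
  have *: "\<exists>h\<in>carrier G. f (Some (i, g, l)) = Some (\<psi> i, h, \<chi> l)" "\<psi> i \<in> J" "\<chi> l \<in> M"
    if "i \<in> I" "g \<in> carrier G" "l \<in> \<Lambda>" for i g l
    using left[OF that] right[OF that] iso_Some[OF f that] by auto
  show thesis
  proof
    show "\<psi> i \<in> J" if "i \<in> I" for i using *(2)[OF that one_closed 0(2)] .
    show "\<chi> l \<in> M" if "l \<in> \<Lambda>" for l using *(3)[OF 0(1) one_closed that] .
    show "P l i \<noteq> None \<longleftrightarrow> Q (\<chi> l) (\<psi> i) \<noteq> None" if m: "i \<in> I" "l \<in> \<Lambda>" for i l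
    proof -
      obtain h h' where h: "f (Some (i0, \<one>, l)) = Some (\<psi> i0, h, \<chi> l)"
        "f (Some (i, \<one>, l0)) = Some (\<psi> i, h', \<chi> l0)"
        using *(1)[OF 0(1) one_closed m(2)] *(1)[OF m(1) one_closed 0(2)] by auto
      \<comment> \<open>This product is nonzero exactly when \<open>P l i\<close> is, and
        \<open>f\<close> maps zero to zero and nonzero elements to nonzero ones.\<close>
      have "f (rees_mult G P (Some (i0, \<one>, l)) (Some (i, \<one>, l0))) =
        rees_mult G Q (Some (\<psi> i0, h, \<chi> l)) (Some (\<psi> i, h', \<chi> l0))"
        using iso_mult[OF f 0(1) one_closed m(2) m(1) one_closed 0(2)] h by simp
      then show ?thesis
        using iso_None[OF f] iso_Some[OF f 0(1) _ 0(2)] entry_closed[OF m(2,1)]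
        by (fastforce split: option.splits)
    qed
  qed (use * in blast)
qed

text \<open>Every \<open>(i, g, l)\<close> is a product of \<open>(i, \<one>, l0)\<close>, some
  \<open>(i0, h, l0)\<close> and \<open>(i0, \<one>, l)\<close>. By \<open>norm\<close> the middle
  factor keeps its group coordinate, so \<open>f\<close> is determined by the images of the outer
  factors, whose group coordinates become \<open>w\<close>. The last two conclusions let prescribed
  images of such outer factors force values of \<phi> and trivial values of
  \<open>w\<close>.\<close>

lemma iso_normalized:
  assumes f: "f \<in> semigroup_iso (rees_semigroup G I \<Lambda> P) (rees_semigroup G J M Q)"
    and B: "rees_matrix G J M Q"
    and 0: "i0 \<in> I" "l0 \<in> \<Lambda>" "P l0 i0 \<noteq> None"
    and norm: "\<And>g. g \<in> carrier G \<Longrightarrow> f (Some (i0, g, l0)) = Some (j0, g, k0)"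
  obtains \<phi> w where "normalized_iso G P Q (I <+> \<Lambda>) (J <+> M) \<phi> w"
    and "\<And>i j. i \<in> I \<Longrightarrow> f (Some (i, \<one>, l0)) = Some (j, \<one>, k0) \<Longrightarrow> \<phi> (Inl i) = Inl j \<and> w (Inl i) = \<one>"
    and "\<And>l k. l \<in> \<Lambda> \<Longrightarrow> f (Some (i0, \<one>, l)) = Some (j0, \<one>, k) \<Longrightarrow> \<phi> (Inr l) = Inr k \<and> w (Inr l) = \<one>"
proof -
  interpret B: rees_matrix G J M Q by (rule B)
  obtain \<psi> \<chi> where \<psi>: "\<And>i. i \<in> I \<Longrightarrow> \<psi> i \<in> J" and \<chi>: "\<And>l. l \<in> \<Lambda> \<Longrightarrow> \<chi> l \<in> M"
    and fS: "\<And>i g l. i \<in> I \<Longrightarrow> g \<in> carrier G \<Longrightarrow> l \<in> \<Lambda> \<Longrightarrow>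
        \<exists>h\<in>carrier G. f (Some (i, g, l)) = Some (\<psi> i, h, \<chi> l)"
    and edge: "\<And>i l. i \<in> I \<Longrightarrow> l \<in> \<Lambda> \<Longrightarrow> P l i \<noteq> None \<longleftrightarrow> Q (\<chi> l) (\<psi> i) \<noteq> None"
    by (rule iso_vertex_maps[OF f]) blast
  obtain p where p: "P l0 i0 = Some p" "p \<in> carrier G" using 0 entry_closed by blast
  define u where "u i = fst (snd (the (f (Some (i, \<one>, l0)))))" for i
  define v where "v l = fst (snd (the (f (Some (i0, \<one>, l)))))" for l
  have \<psi>0: "\<psi> i0 = j0" and \<chi>0: "\<chi> l0 = k0" and u0: "u i0 = \<one>" and v0: "v l0 = \<one>"
    using fS[OF 0(1) one_closed 0(2)] norm[OF one_closed] by (auto simp: u_def v_def)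
  have u: "u i \<in> carrier G" "f (Some (i, \<one>, l0)) = Some (\<psi> i, u i, k0)" if "i \<in> I" for i
    using fS[OF that one_closed 0(2)] \<chi>0 by (auto simp: u_def)
  have v: "v l \<in> carrier G" "f (Some (i0, \<one>, l)) = Some (j0, v l, \<chi> l)" if "l \<in> \<Lambda>" for l
    using fS[OF 0(1) one_closed that] \<psi>0 by (auto simp: v_def)
  \<comment> \<open>Squaring \<open>(i0, \<one>, l0)\<close> transports the entry at the base edge
    unchanged.\<close>
  have q: "Q k0 j0 = Some p"
  proof -
    have "f (rees_mult G P (Some (i0, \<one>, l0)) (Some (i0, \<one>, l0))) =
        rees_mult G Q (Some (j0, \<one>, k0)) (Some (j0, \<one>, k0))"
      using iso_mult[OF f 0(1) one_closed 0(2) 0(1) one_closed 0(2)] norm by simp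
    then show ?thesis
      using p norm[OF p(2)] B.entry_closed[of k0 j0] \<psi>[OF 0(1)] \<chi>[OF 0(2)] \<psi>0 \<chi>0
      by (auto split: option.splits)
  qed
  have form: "f (Some (i, g, l)) = Some (\<psi> i, u i \<otimes> g \<otimes> v l, \<chi> l)"
    if m: "i \<in> I" "g \<in> carrier G" "l \<in> \<Lambda>" for i g l
  proof -
    \<comment> \<open>This is the middle factor for which the triple product has group coordinate
      \<open>g\<close>: both multiplications contribute a factor \<open>p\<close>.\<close>
    define h where "h = inv p \<otimes> g \<otimes> inv p"
    have h: "h \<in> carrier G" "p \<otimes> h \<otimes> p = g"
    proof -
      have "p \<otimes> h = g \<otimes> inv p"
        using p m by (simp add: h_def m_assoc[symmetric])
      then show "p \<otimes> h \<otimes> p = g" using p m by (simp add: m_assoc)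
    qed (use p m in \<open>simp add: h_def\<close>)
    have a: "f (Some (i, p \<otimes> h, l0)) = Some (\<psi> i, u i \<otimes> p \<otimes> h, k0)"
      using iso_mult[OF f m(1) one_closed 0(2) 0(1) h(1) 0(2)] u[OF m(1)] p q norm[OF h(1)] by simp
    have "f (Some (i, p \<otimes> h \<otimes> p, l)) = Some (\<psi> i, u i \<otimes> p \<otimes> h \<otimes> p \<otimes> v l, \<chi> l)"
      using iso_mult[OF f m(1) _ 0(2) 0(1) one_closed m(3), of "p \<otimes> h"] a u[OF m(1)] v[OF m(3)] p q h(1)
      by simp
    moreover have "u i \<otimes> p \<otimes> h \<otimes> p = u i \<otimes> g"
      using u[OF m(1)] p h by (metis m_assoc m_closed)
    ultimately show ?thesis by (simp add: h)
  qed
  have bij: "bij_betw f (carrier (rees_semigroup G I \<Lambda> P)) (carrier (rees_semigroup G J M Q))"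
    by (rule semigroup_iso_bij[OF f])
  have inj: "(i, g, l) = (i', g', l')" if "f (Some (i, g, l)) = f (Some (i', g', l'))"
    "i \<in> I" "g \<in> carrier G" "l \<in> \<Lambda>" "i' \<in> I" "g' \<in> carrier G" "l' \<in> \<Lambda>" for i g l i' g' l'
    using bij that by (fastforce simp: bij_betw_def inj_on_def rees_semigroup_def)
  have surj: "\<exists>i\<in>I. \<exists>g\<in>carrier G. \<exists>l\<in>\<Lambda>. f (Some (i, g, l)) = Some (j, \<one>, k)"
    if "j \<in> J" "k \<in> M" for j k
  proof -
    have "Some (j, \<one>, k) \<in> f ` carrier (rees_semigroup G I \<Lambda> P)"
      using bij that by (auto simp: bij_betw_def rees_semigroup_def)
    then obtain z where "z \<in> carrier (rees_semigroup G I \<Lambda> P)" "f z = Some (j, \<one>, k)" by auto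
    then show ?thesis using iso_None[OF f] by (cases z) (auto simp: rees_semigroup_def)
  qed
  have "inj_on \<psi> I"
  proof (rule inj_onI)
    fix i i' assume i: "i \<in> I" "i' \<in> I" "\<psi> i = \<psi> i'"
    \<comment> \<open>The inverse cancels \<open>u i\<close>, so the two images agree in the group
      coordinate as well as in the indices.\<close>
    then have "f (Some (i, inv (u i), l0)) = f (Some (i', inv (u i'), l0))"
      using 0 u v by (simp add: form)
    from inj[OF this] show "i = i'" using i 0 u by simp
  qed
  moreover have "\<psi> ` I = J"
  proof
    show "J \<subseteq> \<psi> ` I"
    proof
      fix j assume "j \<in> J"
      then obtain i g l where "i \<in> I" "g \<in> carrier G" "l \<in> \<Lambda>" "f (Some (i, g, l)) = Some (j, \<one>, k0)"
        using surj \<chi>[OF 0(2)] \<chi>0 by blast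
      then show "j \<in> \<psi> ` I" using form by auto
    qed
  qed (use \<psi> in auto)
  moreover have "inj_on \<chi> \<Lambda>"
  proof (rule inj_onI)
    fix l l' assume l: "l \<in> \<Lambda>" "l' \<in> \<Lambda>" "\<chi> l = \<chi> l'"
    then have "f (Some (i0, inv (v l), l)) = f (Some (i0, inv (v l'), l'))"
      using 0 u0 v by (simp add: form)
    from inj[OF this] show "l = l'" using l 0 v by simp
  qed
  moreover have "\<chi> ` \<Lambda> = M"
  proof
    show "M \<subseteq> \<chi> ` \<Lambda>"
    proof
      fix k assume "k \<in> M"
      then obtain i g l where "i \<in> I" "g \<in> carrier G" "l \<in> \<Lambda>" "f (Some (i, g, l)) = Some (j0, \<one>, k)"
        using surj \<psi>[OF 0(1)] \<psi>0 by blast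
      then show "k \<in> \<chi> ` \<Lambda>" using form by auto
    qed
  qed (use \<chi> in auto)
  ultimately have bij: "bij_betw (map_sum \<psi> \<chi>) (I <+> \<Lambda>) (J <+> M)"
    by (intro bij_betw_map_sum) (simp_all add: bij_betw_def)
  have entry: "P l i = map_option (\<lambda>q. v l \<otimes> q \<otimes> u i) (Q (\<chi> l) (\<psi> i))"
    if m: "i \<in> I" "l \<in> \<Lambda>" for i l
  proof (cases "P l i")
    case None
    then show ?thesis using edge[OF m] by simp
  next
    case (Some r)
    then obtain q where q: "Q (\<chi> l) (\<psi> i) = Some q" using edge[OF m] by auto
    have r: "r \<in> carrier G" using Some m entry_closed by blast
    \<comment> \<open>The element \<open>(i0, r, l0)\<close> is the product of
      \<open>(i0, \<one>, l)\<close> and \<open>(i, \<one>, l0)\<close>. Computing its image from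
      this product and comparing with \<open>norm\<close> yields the relation between the two
      matrices.\<close>
    have "f (Some (i0, r, l0)) = Some (j0, v l \<otimes> q \<otimes> u i, k0)"
      using iso_mult[OF f 0(1) one_closed m(2) m(1) one_closed 0(2)] Some q u[OF m(1)] v[OF m(2)] r by simp
    then show ?thesis using norm[OF r] Some q by simp
  qed
  show thesis
  proof
    show "normalized_iso G P Q (I <+> \<Lambda>) (J <+> M) (map_sum \<psi> \<chi>) (case_sum u v)"
      using bij entry u v by (auto simp: normalized_iso_def vertex_entry_def)
    show "map_sum \<psi> \<chi> (Inl i) = Inl j \<and> case_sum u v (Inl i) = \<one>"
      if "i \<in> I" "f (Some (i, \<one>, l0)) = Some (j, \<one>, k0)" for i j
      using u[OF that(1)] that by simp
    show "map_sum \<psi> \<chi> (Inr l) = Inr k \<and> case_sum u v (Inr l) = \<one>"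
      if "l \<in> \<Lambda>" "f (Some (i0, \<one>, l)) = Some (j0, \<one>, k)" for l k
      using v[OF that(1)] that by simp
  qed
qed

text \<open>In a product of two images, the factors \<open>w (Inr l)\<close> and
  \<open>w (Inl j)\<close> surround the entry at the image vertices, and the entry condition turns
  this into \<open>P l j\<close>. Bijectivity combines that of \<phi> on vertices with cancellation
  of \<open>w\<close> in the group.\<close>

lemma normalized_iso_induces_iso:
  assumes n: "normalized_iso G P P (I <+> \<Lambda>) (I <+> \<Lambda>) \<phi> w"
  defines "F \<equiv> map_option (\<lambda>(i, g, l).
      (projl (\<phi> (Inl i)), w (Inl i) \<otimes> g \<otimes> w (Inr l), projr (\<phi> (Inr l))))"
  shows "F \<in> semigroup_iso (rees_semigroup G I \<Lambda> P) (rees_semigroup G I \<Lambda> P)"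
proof -
  define \<psi> where "\<psi> i = projl (\<phi> (Inl i))" for i
  define \<chi> where "\<chi> l = projr (\<phi> (Inr l))" for l
  have w: "i \<in> I \<Longrightarrow> w (Inl i) \<in> carrier G" "l \<in> \<Lambda> \<Longrightarrow> w (Inr l) \<in> carrier G" for i l
    using n by (auto simp: normalized_iso_def)
  have \<psi>: "\<phi> (Inl i) = Inl (\<psi> i)" if "i \<in> I" for i
    using n that unfolding normalized_iso_def \<psi>_def by (metis InlI sum.collapse(1) sum.disc(1))
  have \<chi>: "\<phi> (Inr l) = Inr (\<chi> l)" if "l \<in> \<Lambda>" for l
    using n that unfolding normalized_iso_def \<chi>_def by (metis InrI sum.collapse(2) sum.disc(2))
  have inj: "inj_on \<phi> (I <+> \<Lambda>)" and im: "\<phi> ` (I <+> \<Lambda>) = I <+> \<Lambda>"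
    using n by (auto simp: normalized_iso_def bij_betw_def)
  have \<psi>I: "\<psi> i \<in> I" if "i \<in> I" for i 
    using imageI[of "Inl i" "I <+> \<Lambda>" \<phi>] im \<psi>[OF that] that by auto
  have \<chi>L: "\<chi> l \<in> \<Lambda>" if "l \<in> \<Lambda>" for l 
    using imageI[of "Inr l" "I <+> \<Lambda>" \<phi>] im \<chi>[OF that] that by auto
  have \<psi>inj: "inj_on \<psi> I"
  proof (rule inj_onI)
    fix i j assume "i \<in> I" "j \<in> I" "\<psi> i = \<psi> j"
    then show "i = j" using inj_onD[OF inj, of "Inl i" "Inl j"] \<psi> by auto
  qed
  have \<chi>inj: "inj_on \<chi> \<Lambda>"
  proof (rule inj_onI)
    fix k l assume "k \<in> \<Lambda>" "l \<in> \<Lambda>" "\<chi> k = \<chi> l"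
    then show "k = l" using inj_onD[OF inj, of "Inr k" "Inr l"] \<chi> by auto
  qed
  have \<psi>surj: "\<exists>i\<in>I. j = \<psi> i" if j: "j \<in> I" for j
  proof -
    have "Inl j \<in> \<phi> ` (I <+> \<Lambda>)" using j im by auto
    then show ?thesis using \<psi> \<chi> by auto
  qed
  have \<chi>surj: "\<exists>l\<in>\<Lambda>. k = \<chi> l" if k: "k \<in> \<Lambda>" for k
  proof -
    have "Inr k \<in> \<phi> ` (I <+> \<Lambda>)" using k im by auto
    then show ?thesis using \<psi> \<chi> by auto
  qed
  have entry: "P l i = map_option (\<lambda>q. w (Inr l) \<otimes> q \<otimes> w (Inl i)) (P (\<chi> l) (\<psi> i))"
    if "i \<in> I" "l \<in> \<Lambda>" for i l
  proof -
    have "vertex_entry P (Inr l) (Inl i) = map_option (\<lambda>q. w (Inr l) \<otimes> q \<otimes> w (Inl i))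
      (vertex_entry P (\<phi> (Inr l)) (\<phi> (Inl i)))"
      using n that by (auto simp: normalized_iso_def)
    then show ?thesis using \<psi> \<chi> that by (simp add: vertex_entry_def)
  qed
  have F: "F (Some (i, g, l)) = Some (\<psi> i, w (Inl i) \<otimes> g \<otimes> w (Inr l), \<chi> l)" "F None = None" for i g l
    by (auto simp: F_def \<psi>_def \<chi>_def)
  let ?S = "rees_semigroup G I \<Lambda> P"
  have closed: "F x \<in> carrier ?S" if "x \<in> carrier ?S" for x
    using that w \<psi>I \<chi>L by (auto simp: rees_semigroup_def F)
  have "inj_on F (carrier ?S)"
  proof (rule inj_onI)
    fix x y assume xy: "x \<in> carrier ?S" "y \<in> carrier ?S" "F x = F y"
    show "x = y"
    proof (cases "x = None \<or> y = None")
      case True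
      then show ?thesis using xy(3) by (cases x; cases y) (auto simp: F_def)
    next
      case False
      then obtain i g l j h k where x: "x = Some (i, g, l)" "i \<in> I" "g \<in> carrier G" "l \<in> \<Lambda>"
        and y: "y = Some (j, h, k)" "j \<in> I" "h \<in> carrier G" "k \<in> \<Lambda>"
        using xy by (auto simp: rees_semigroup_def)
      have "i = j" "l = k"
        using xy(3) x y inj_onD[OF \<psi>inj, of i j] inj_onD[OF \<chi>inj, of l k] by (auto simp: F)
      then show ?thesis using xy(3) x y w by (simp add: F)
    qed
  qed
  moreover have "carrier ?S \<subseteq> F ` carrier ?S"
  proof
    fix y assume y: "y \<in> carrier ?S"
    show "y \<in> F ` carrier ?S"
    proof (cases y)
      case None
      then show ?thesis using F(2) by (force simp: rees_semigroup_def)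
    next
      case (Some a)
      then obtain j h k where jhk: "y = Some (j, h, k)" "j \<in> I" "h \<in> carrier G" "k \<in> \<Lambda>"
        using y by (auto simp: rees_semigroup_def)
      obtain i l where il: "i \<in> I" "j = \<psi> i" "l \<in> \<Lambda>" "k = \<chi> l" using \<psi>surj \<chi>surj jhk by blast
      have "w (Inl i) \<otimes> (inv w (Inl i) \<otimes> h \<otimes> inv w (Inr l)) \<otimes> w (Inr l) = h"
        using w il jhk by (simp add: m_assoc) (simp add: m_assoc[symmetric])
      then have "y = F (Some (i, inv w (Inl i) \<otimes> h \<otimes> inv w (Inr l), l))"
        using il jhk by (simp add: F)
      then show ?thesis using il jhk w by (auto simp: rees_semigroup_def)
    qed
  qed
  moreover have "F (op ?S x y) = op ?S (F x) (F y)" if xy: "x \<in> carrier ?S" "y \<in> carrier ?S" for x y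
  proof (cases "x = None \<or> y = None")
    case True
    then show ?thesis by (cases x; cases y) (auto simp: rees_semigroup_def F)
  next
    case False
    then obtain i g l j h k where x: "x = Some (i, g, l)" "i \<in> I" "g \<in> carrier G" "l \<in> \<Lambda>"
      and y: "y = Some (j, h, k)" "j \<in> I" "h \<in> carrier G" "k \<in> \<Lambda>"
      using xy by (auto simp: rees_semigroup_def)
    show ?thesis
    proof (cases "P (\<chi> l) (\<psi> j)")
      case None
      then show ?thesis using entry[of j l] x y by (simp add: rees_semigroup_def F)
    next
      case (Some q)
      have "q \<in> carrier G" using Some entry_closed \<psi>I \<chi>L x y by blast
      then show ?thesis using Some entry[of j l] x y w by (simp add: rees_semigroup_def F m_assoc)
    qed
  qed
  ultimately show ?thesis
    using closed by (auto simp: semigroup_iso_def bij_betw_def)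
qed

section \<open>Connected components of the bipartite graph\<close>

lemma rees_edges_iff:
  "(x, y) \<in> rees_edges I \<Lambda> P \<longleftrightarrow>
    x \<in> I <+> \<Lambda> \<and> y \<in> I <+> \<Lambda> \<and> (vertex_entry P x y \<noteq> None \<or> vertex_entry P y x \<noteq> None)"
  by (cases x; cases y) (auto simp: rees_edges_def Let_def vertex_entry_def)

lemma sym_rees_edges: "sym (rees_edges I \<Lambda> P)"
  by (auto simp: sym_def rees_edges_iff)

lemma equiv_connected:
  "equiv (I <+> \<Lambda>) {(u, v). u \<in> I <+> \<Lambda> \<and> v \<in> I <+> \<Lambda> \<and> (u, v) \<in> (rees_edges I \<Lambda> P)\<^sup>*}"
  using sym_rtrancl[OF sym_rees_edges]
  by (intro equivI) (auto simp: refl_on_def sym_def trans_def)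

lemma component_subset: "C \<in> rees_graph_components I \<Lambda> P \<Longrightarrow> C \<subseteq> I <+> \<Lambda>"
  unfolding rees_graph_components_def quotient_def by blast

lemma component_connected:
  "C \<in> rees_graph_components I \<Lambda> P \<Longrightarrow> x \<in> C \<Longrightarrow> y \<in> C \<Longrightarrow> (x, y) \<in> (rees_edges I \<Lambda> P)\<^sup>*"
  using quotient_eq_iff[OF equiv_connected, of C C x y] by (auto simp: rees_graph_components_def)

lemma component_closed:
  assumes "C \<in> rees_graph_components I \<Lambda> P" "x \<in> C" "(x, y) \<in> (rees_edges I \<Lambda> P)\<^sup>*"
  shows "y \<in> C"
proof -
  have "y \<in> I <+> \<Lambda>"
    using assms(3) component_subset[OF assms(1)] assms(2)
    by (induction rule: rtrancl_induct) (auto simp: rees_edges_iff)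
  then show ?thesis
    using assms component_subset[OF assms(1)] in_quotient_imp_closed[OF equiv_connected, of C x y]
    by (auto simp: rees_graph_components_def)
qed

lemma component_unique:
  "C \<in> rees_graph_components I \<Lambda> P \<Longrightarrow> D \<in> rees_graph_components I \<Lambda> P \<Longrightarrow> x \<in> C \<Longrightarrow> x \<in> D \<Longrightarrow> C = D"
  using quotient_disj[OF equiv_connected] unfolding rees_graph_components_def by blast

lemma component_exists: "x \<in> I <+> \<Lambda> \<Longrightarrow> \<exists>C\<in>rees_graph_components I \<Lambda> P. x \<in> C"
  using Union_quotient[OF equiv_connected] unfolding rees_graph_components_def by blast

text \<open>A nonzero entry is an edge, and an edge does not leave a component. Hence the submatrix
  of a component inherits the absence of zero rows and columns.\<close>

lemma component_neighbour:
  assumes "C \<in> rees_graph_components I \<Lambda> P" "x \<in> C"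
  shows "(case x of Inl i \<Rightarrow> \<exists>l. Inr l \<in> C \<and> P l i \<noteq> None | Inr l \<Rightarrow> \<exists>i. Inl i \<in> C \<and> P l i \<noteq> None)"
proof (cases x)
  case (Inl i)
  then have "i \<in> I" using component_subset assms by blast
  then obtain l where "l \<in> \<Lambda>" "P l i \<noteq> None" using no_zero_column by blast
  moreover from this have "(x, Inr l) \<in> rees_edges I \<Lambda> P"
    using Inl \<open>i \<in> I\<close> by (auto simp: rees_edges_iff vertex_entry_def)
  ultimately show ?thesis using Inl component_closed[OF assms] by auto
next
  case (Inr l)
  then have "l \<in> \<Lambda>" using component_subset assms by blast
  then obtain i where "i \<in> I" "P l i \<noteq> None" using no_zero_row by blast
  moreover from this have "(x, Inl i) \<in> rees_edges I \<Lambda> P"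
    using Inr \<open>l \<in> \<Lambda>\<close> by (auto simp: rees_edges_iff vertex_entry_def)
  ultimately show ?thesis using Inr component_closed[OF assms] by auto
qed

lemma component_edge:
  assumes C: "C \<in> rees_graph_components I \<Lambda> P"
  shows "\<exists>i l. Inl i \<in> C \<and> Inr l \<in> C \<and> P l i \<noteq> None"
proof -
  have "C \<noteq> {}"
    using C in_quotient_imp_non_empty[OF equiv_connected] unfolding rees_graph_components_def by blast
  then obtain x where "x \<in> C" by blast
  then show ?thesis using component_neighbour[OF C, of x] by (cases x) auto
qed

text \<open>This makes the results on isomorphisms of Rees matrix semigroups available for each
  component.\<close>

lemma component_rees_matrix:
  assumes C: "C \<in> rees_graph_components I \<Lambda> P"
  shows "rees_matrix G (Inl -` C) (Inr -` C) P"
proof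
  show "Inl -` C \<noteq> {}" "Inr -` C \<noteq> {}" using component_edge[OF C] by auto
  show "P l i \<in> insert None (Some ` carrier G)" if "l \<in> Inr -` C" "i \<in> Inl -` C" for l i
    using that component_subset[OF C] by (intro entries) auto
  show "\<exists>i\<in>Inl -` C. P l i \<noteq> None" if "l \<in> Inr -` C" for l
    using component_neighbour[OF C, of "Inr l"] that by auto
  show "\<exists>l\<in>Inr -` C. P l i \<noteq> None" if "i \<in> Inl -` C" for i
    using component_neighbour[OF C, of "Inl i"] that by auto
qed

lemma component_semigroup_closed:
  assumes "C \<in> rees_graph_components I \<Lambda> P"
    and "x \<in> carrier (rees_component G I \<Lambda> P C)" "y \<in> carrier (rees_component G I \<Lambda> P C)"
  shows "op (rees_component G I \<Lambda> P C) x y \<in> carrier (rees_component G I \<Lambda> P C)"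
  using rees_matrix.rees_closed[OF component_rees_matrix[OF assms(1)]] assms(2-)
  by (simp add: rees_component_eq_rees_semigroup)

lemma component_carrier_subset:
  "C \<in> rees_graph_components I \<Lambda> P \<Longrightarrow>
    carrier (rees_component G I \<Lambda> P C) \<subseteq> carrier (rees_semigroup G I \<Lambda> P)"
  using component_subset by (fastforce simp: rees_component_eq_rees_semigroup rees_semigroup_def)

section \<open>Restricting automorphisms to components and gluing isomorphisms of components\<close>

text \<open>The vertex maps of \<open>f\<close> preserve edges and hence paths, so one vertex of the
  connected set \<open>C\<close> landing in \<open>D\<close> takes all of \<open>C\<close> along.
  The anchor \<open>e\<close> is nonzero because zero lies in every Rees component and would not
  locate any vertex.\<close>

lemma automorphism_maps_component:
  assumes f: "f \<in> semigroup_iso (rees_semigroup G I \<Lambda> P) (rees_semigroup G I \<Lambda> P)"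
    and C: "C \<in> rees_graph_components I \<Lambda> P" and D: "D \<in> rees_graph_components I \<Lambda> P"
    and e: "e \<in> carrier (rees_component G I \<Lambda> P C)" "e \<noteq> None" "f e \<in> carrier (rees_component G I \<Lambda> P D)"
    and x: "x \<in> carrier (rees_component G I \<Lambda> P C)"
  shows "f x \<in> carrier (rees_component G I \<Lambda> P D)"
proof (cases x)
  case None
  then show ?thesis using iso_None[OF f] by (simp add: rees_component_eq_rees_semigroup rees_semigroup_def)
next
  case (Some a)
  obtain \<psi> \<chi> where \<psi>: "\<And>i. i \<in> I \<Longrightarrow> \<psi> i \<in> I" and \<chi>: "\<And>l. l \<in> \<Lambda> \<Longrightarrow> \<chi> l \<in> \<Lambda>"
    and fS: "\<And>i g l. i \<in> I \<Longrightarrow> g \<in> carrier G \<Longrightarrow> l \<in> \<Lambda> \<Longrightarrow>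
        \<exists>h\<in>carrier G. f (Some (i, g, l)) = Some (\<psi> i, h, \<chi> l)"
    and edge: "\<And>i l. i \<in> I \<Longrightarrow> l \<in> \<Lambda> \<Longrightarrow> P l i \<noteq> None \<longleftrightarrow> P (\<chi> l) (\<psi> i) \<noteq> None"
    by (rule iso_vertex_maps[OF f]) blast
  have step: "(map_sum \<psi> \<chi> u, map_sum \<psi> \<chi> v) \<in> rees_edges I \<Lambda> P" if "(u, v) \<in> rees_edges I \<Lambda> P" for u v
    using that \<psi> \<chi> edge by (cases u; cases v) (auto simp: rees_edges_iff vertex_entry_def)
  have path: "(map_sum \<psi> \<chi> u, map_sum \<psi> \<chi> v) \<in> (rees_edges I \<Lambda> P)\<^sup>*"
    if "(u, v) \<in> (rees_edges I \<Lambda> P)\<^sup>*" for u v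
    using that by (induction rule: rtrancl_induct) (auto intro: step rtrancl_into_rtrancl)
  obtain i0 g0 l0 where e0: "e = Some (i0, g0, l0)" "Inl i0 \<in> C" "g0 \<in> carrier G" "Inr l0 \<in> C"
    using e by (auto simp: rees_component_eq_rees_semigroup rees_semigroup_def)
  have I0: "i0 \<in> I" "l0 \<in> \<Lambda>" using e0 component_subset[OF C] by auto
  have "Inl (\<psi> i0) \<in> D"
    using fS[OF I0(1) e0(3) I0(2)] e0(1) e(3)
    by (auto simp: rees_component_eq_rees_semigroup rees_semigroup_def)
  then have img: "map_sum \<psi> \<chi> v \<in> D" if "v \<in> C" for v
    using component_closed[OF D _ path[OF component_connected[OF C e0(2) that]]] by simp
  obtain i g l where y: "x = Some (i, g, l)" "Inl i \<in> C" "g \<in> carrier G" "Inr l \<in> C"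
    using Some x by (auto simp: rees_component_eq_rees_semigroup rees_semigroup_def)
  have "i \<in> I" "l \<in> \<Lambda>" using y component_subset[OF C] by auto
  from fS[OF this(1) y(3) this(2)] show ?thesis
    using img[OF y(2)] img[OF y(4)] y(1) by (auto simp: rees_component_eq_rees_semigroup rees_semigroup_def)
qed

text \<open>Surjectivity onto the second component follows by applying
  \<open>automorphism_maps_component\<close> to the inverse of \<open>f\<close> with anchor
  \<open>f e\<close>.\<close>

lemma automorphism_restricts:
  assumes f: "f \<in> semigroup_iso (rees_semigroup G I \<Lambda> P) (rees_semigroup G I \<Lambda> P)"
    and C: "C \<in> rees_graph_components I \<Lambda> P" and D: "D \<in> rees_graph_components I \<Lambda> P"
    and e: "e \<in> carrier (rees_component G I \<Lambda> P C)" "e \<noteq> None" "f e \<in> carrier (rees_component G I \<Lambda> P D)"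
  shows "f \<in> semigroup_iso (rees_component G I \<Lambda> P C) (rees_component G I \<Lambda> P D)"
proof -
  let ?S = "rees_semigroup G I \<Lambda> P"
  let ?g = "inv_into (carrier ?S) f"
  have g: "?g \<in> semigroup_iso ?S ?S" by (rule semigroup_iso_inv_into[OF f rees_closed])
  have b: "bij_betw f (carrier ?S) (carrier ?S)" by (rule semigroup_iso_bij[OF f])
  have eS: "e \<in> carrier ?S" using e(1) component_carrier_subset[OF C] by blast
  have "None \<in> carrier ?S" by (simp add: rees_semigroup_def)
  then have fe: "f e \<noteq> None"
    using inj_onD[OF bij_betw_imp_inj_on[OF b], of e None] iso_None[OF f] eS e(2) by metis
  have ge: "?g (f e) = e" using bij_betw_inv_into_left[OF b eS] .
  have "carrier (rees_component G I \<Lambda> P D) \<subseteq> f ` carrier (rees_component G I \<Lambda> P C)"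
  proof
    fix y assume y: "y \<in> carrier (rees_component G I \<Lambda> P D)"
    have "?g y \<in> carrier (rees_component G I \<Lambda> P C)"
      using automorphism_maps_component[OF g D C e(3) fe _ y] ge e(1) by simp
    moreover have "f (?g y) = y"
      using b y component_carrier_subset[OF D] by (auto intro: bij_betw_inv_into_right)
    ultimately show "y \<in> f ` carrier (rees_component G I \<Lambda> P C)" by force
  qed
  then have "f ` carrier (rees_component G I \<Lambda> P C) = carrier (rees_component G I \<Lambda> P D)"
    using automorphism_maps_component[OF f C D e] by blast
  then have "bij_betw f (carrier (rees_component G I \<Lambda> P C)) (carrier (rees_component G I \<Lambda> P D))"
    using b component_carrier_subset[OF C] by (metis bij_betw_subset)
  moreover have "op (rees_component G I \<Lambda> P B) = op ?S" for B
    by (simp add: rees_component_def)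
  moreover have "f (op ?S x y) = op ?S (f x) (f y)"
    if "x \<in> carrier (rees_component G I \<Lambda> P C)" "y \<in> carrier (rees_component G I \<Lambda> P C)" for x y
    using that component_carrier_subset[OF C] by (intro semigroup_iso_op[OF f]) auto
  ultimately show ?thesis by (simp add: semigroup_iso_def)
qed

text \<open>Entries between distinct components are zero, and injectivity of \<open>p\<close> keeps
  distinct components distinct. So only pairs of vertices within one component impose a condition,
  and there the local isomorphism supplies it.\<close>

lemma glue_normalized_isos:
  assumes p: "bij_betw p (rees_graph_components I \<Lambda> P) (rees_graph_components I \<Lambda> P)"
    and n: "\<And>C. C \<in> rees_graph_components I \<Lambda> P \<Longrightarrow> normalized_iso G P P C (p C) (\<phi> C) (w C)"
    and c: "\<And>x. x \<in> I <+> \<Lambda> \<Longrightarrow> c x \<in> rees_graph_components I \<Lambda> P \<and> x \<in> c x"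
  shows "normalized_iso G P P (I <+> \<Lambda>) (I <+> \<Lambda>) (\<lambda>x. \<phi> (c x) x) (\<lambda>x. w (c x) x)"
proof -
  let ?V = "I <+> \<Lambda>" and ?K = "rees_graph_components I \<Lambda> P"
  have pK: "p C \<in> ?K" if "C \<in> ?K" for C using p that by (auto simp: bij_betw_apply)
  have bij: "bij_betw (\<phi> C) C (p C)" if "C \<in> ?K" for C using n[OF that] by (simp add: normalized_iso_def)
  have mem: "\<phi> (c x) x \<in> p (c x)" if "x \<in> ?V" for x
    using bij_betw_apply[OF bij] c[OF that] by blast
  have V: "\<phi> (c x) x \<in> ?V" if "x \<in> ?V" for x
    using mem[OF that] component_subset[OF pK] c[OF that] by blast
  have "inj_on (\<lambda>x. \<phi> (c x) x) ?V"
  proof (rule inj_onI)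
    fix x y assume x: "x \<in> ?V" and y: "y \<in> ?V" and eq: "\<phi> (c x) x = \<phi> (c y) y"
    have "p (c x) = p (c y)"
      using component_unique[OF pK pK] mem[OF x] mem[OF y] c[OF x] c[OF y] eq by metis
    then have "c x = c y"
      using inj_onD[OF bij_betw_imp_inj_on[OF p]] c[OF x] c[OF y] by blast
    then show "x = y"
      using inj_onD[OF bij_betw_imp_inj_on[OF bij]] c[OF x] c[OF y] eq by metis
  qed
  moreover have "?V \<subseteq> (\<lambda>x. \<phi> (c x) x) ` ?V"
  proof
    fix y assume y: "y \<in> ?V"
    obtain C where C: "C \<in> ?K" "p C = c y"
      using p c[OF y] by (metis bij_betw_imp_surj_on imageE)
    obtain x where x: "x \<in> C" "\<phi> C x = y"
      using bij[OF C(1)] c[OF y] C(2) by (metis bij_betw_imp_surj_on imageE)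
    have "x \<in> ?V" using x C component_subset by blast
    moreover from this have "c x = C" using component_unique c C x by blast
    ultimately show "y \<in> (\<lambda>x. \<phi> (c x) x) ` ?V" using x by blast
  qed
  moreover have "vertex_entry P x y =
      map_option (\<lambda>q. w (c x) x \<otimes> q \<otimes> w (c y) y) (vertex_entry P (\<phi> (c x) x) (\<phi> (c y) y))"
    if x: "x \<in> ?V" and y: "y \<in> ?V" for x y
  proof (cases "c x = c y")
    case True
    then show ?thesis using n[of "c x"] c[OF x] c[OF y] by (auto simp: normalized_iso_def)
  next
    case False
    have far: "vertex_entry P a b = None"
      if "C \<in> ?K" "D \<in> ?K" "C \<noteq> D" "a \<in> C" "b \<in> D" for C D a b
    proof (rule ccontr)
      assume "vertex_entry P a b \<noteq> None"
      then have "(a, b) \<in> rees_edges I \<Lambda> P"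
        using that component_subset by (auto simp: rees_edges_iff)
      then show False using component_closed[OF that(1,4)] component_unique that by blast
    qed
    have "p (c x) \<noteq> p (c y)"
      using False inj_onD[OF bij_betw_imp_inj_on[OF p]] c[OF x] c[OF y] by blast
    then have "vertex_entry P (\<phi> (c x) x) (\<phi> (c y) y) = None"
      using far[OF pK pK] mem[OF x] mem[OF y] c[OF x] c[OF y] by blast
    moreover have "vertex_entry P x y = None"
      using far False c[OF x] c[OF y] by blast
    ultimately show ?thesis by simp
  qed
  moreover have "isl (\<phi> (c x) x) = isl x \<and> w (c x) x \<in> carrier G" if "x \<in> ?V" for x
    using n[of "c x"] c[OF that] by (auto simp: normalized_iso_def)
  moreover have "(\<lambda>x. \<phi> (c x) x) ` ?V \<subseteq> ?V" using V by blast
  ultimately show ?thesis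
    unfolding normalized_iso_def bij_betw_def by (intro conjI ballI equalityI) blast+
qed

section \<open>From the semigroup to its components\<close>

text \<open>A fixed nonzero \<open>e\<close> of the component is prefixed to each tuple. An
  automorphism of the whole semigroup relating two prefixed tuples fixes \<open>e\<close>, so it
  restricts to an automorphism of the component.\<close>

lemma categorical_imp_component_categorical:
  assumes S: "aleph0_categorical (rees_semigroup G I \<Lambda> P)" and C: "C \<in> rees_graph_components I \<Lambda> P"
  shows "aleph0_categorical (rees_component G I \<Lambda> P C)"
proof -
  let ?S = "rees_semigroup G I \<Lambda> P" and ?T = "rees_component G I \<Lambda> P C"
  obtain i l where il: "Inl i \<in> C" "Inr l \<in> C" using component_edge[OF C] by blast
  define e where "e = Some (i, \<one>, l)"
  have e: "e \<in> carrier ?T" "e \<noteq> None"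
    using il by (auto simp: e_def rees_component_eq_rees_semigroup rees_semigroup_def)
  have sub: "carrier ?T \<subseteq> carrier ?S" by (rule component_carrier_subset[OF C])
  have "finite (tuples ?T n // same_orbit ?T n)" for n
  proof (rule finite_quotient_by_invariant)
    let ?h = "\<lambda>xs. same_orbit ?S (Suc n) `` {e # xs}"
    show "equiv (tuples ?T n) (same_orbit ?T n)"
      by (rule equiv_same_orbit[OF component_semigroup_closed[OF C]])
    have t: "e # xs \<in> tuples ?S (Suc n)" if "xs \<in> tuples ?T n" for xs
      using that e sub by (auto simp: tuples_def)
    then have "?h ` tuples ?T n \<subseteq> (\<lambda>ys. same_orbit ?S (Suc n) `` {ys}) ` tuples ?S (Suc n)"
      by blast
    moreover have "finite (tuples ?S (Suc n) // same_orbit ?S (Suc n))"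
      using S by (simp add: aleph0_categorical_def)
    ultimately show "finite (?h ` tuples ?T n)"
      using finite_orbit_classes finite_subset by blast
    fix xs ys assume xs: "xs \<in> tuples ?T n" and ys: "ys \<in> tuples ?T n" and eq: "?h xs = ?h ys"
    then have "(e # xs, e # ys) \<in> same_orbit ?S (Suc n)"
      using same_orbit_refl[OF t[OF ys]] by blast
    then obtain f where f: "f \<in> semigroup_iso ?S ?S" "f e = e" "ys = map f xs"
      by (auto simp: same_orbit_def)
    then have "f \<in> semigroup_iso ?T ?T" using automorphism_restricts[OF f(1) C C e] e by simp
    then show "(xs, ys) \<in> same_orbit ?T n" using f xs ys by (auto simp: same_orbit_def)
  qed
  moreover have "countable (carrier ?T)"
    using S sub countable_subset by (auto simp: aleph0_categorical_def)
  ultimately show ?thesis by (simp add: aleph0_categorical_def)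
qed

text \<open>Orbits on 1-tuples suffice: choose a nonzero element in each component. If two chosen
  elements lie in one orbit, the automorphism relating them restricts to an isomorphism of their
  components.\<close>

lemma categorical_imp_finitely_many:
  assumes S: "aleph0_categorical (rees_semigroup G I \<Lambda> P)"
  shows "finitely_many_up_to_iso (connected_rees_components G I \<Lambda> P)"
  unfolding finitely_many_up_to_iso_def
proof (rule finite_quotient_by_invariant)
  let ?S = "rees_semigroup G I \<Lambda> P" and ?Q = "connected_rees_components G I \<Lambda> P"
  define e where "e T = (SOME x. x \<in> carrier T \<and> x \<noteq> None)" for T :: "('i \<times> 'g \<times> 'l) option binary_structure"
  have e: "e T \<in> carrier T \<and> e T \<noteq> None" if "T \<in> ?Q" for T
  proof -
    obtain C where C: "C \<in> rees_graph_components I \<Lambda> P" "T = rees_component G I \<Lambda> P C"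
      using \<open>T \<in> ?Q\<close> by (auto simp: connected_rees_components_def)
    obtain i l where "Inl i \<in> C" "Inr l \<in> C" using component_edge[OF C(1)] by blast
    then have "Some (i, \<one>, l) \<in> carrier T \<and> Some (i, \<one>, l) \<noteq> None"
      by (auto simp: C(2) rees_component_eq_rees_semigroup rees_semigroup_def)
    then show ?thesis unfolding e_def by (rule someI)
  qed
  let ?h = "\<lambda>T. same_orbit ?S 1 `` {[e T]}"
  show "equiv ?Q {(S, T). S \<in> ?Q \<and> T \<in> ?Q \<and> isomorphic S T}"
    using component_semigroup_closed by (intro equiv_isomorphic) (auto simp: connected_rees_components_def)
  have t: "[e T] \<in> tuples ?S 1" if "T \<in> ?Q" for T
    using e[OF that] that component_carrier_subset by (fastforce simp: tuples_def connected_rees_components_def)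
  then have "?h ` ?Q \<subseteq> (\<lambda>ys. same_orbit ?S 1 `` {ys}) ` tuples ?S 1"
    by blast
  moreover have "finite (tuples ?S 1 // same_orbit ?S 1)"
    using S by (simp add: aleph0_categorical_def)
  ultimately show "finite (?h ` ?Q)"
    using finite_orbit_classes finite_subset by blast
  fix T U assume T: "T \<in> ?Q" and U: "U \<in> ?Q" and eq: "?h T = ?h U"
  then have "([e T], [e U]) \<in> same_orbit ?S 1"
    using same_orbit_refl[OF t[OF U]] by blast
  then obtain f where f: "f \<in> semigroup_iso ?S ?S" "f (e T) = e U"
    by (auto simp: same_orbit_def)
  obtain C D where CD: "C \<in> rees_graph_components I \<Lambda> P" "T = rees_component G I \<Lambda> P C"
    "D \<in> rees_graph_components I \<Lambda> P" "U = rees_component G I \<Lambda> P D"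
    using T U by (auto simp: connected_rees_components_def)
  have "f \<in> semigroup_iso T U"
    using automorphism_restricts[OF f(1) CD(1,3), of "e T"] e[OF T] e[OF U] f(2)
    unfolding CD(2,4) by simp
  then show "(T, U) \<in> {(S, T). S \<in> ?Q \<and> T \<in> ?Q \<and> isomorphic S T}"
    using T U by (auto simp: isomorphic_def)
qed

section \<open>From the components back to the semigroup\<close>

text \<open>With \<open>gs\<close> enumerating \<open>G\<close>, the first part forces the automorphism of \<open>G\<close> to be trivial. In the
  second part \<open>None\<close> marks the vertices outside \<open>C\<close>; the vertices \<open>Inl i\<close> and \<open>Inr l\<close> yield the same
  entry, so the sides of the vertices have to be recorded separately.\<close>

definition probe :: "'g list \<Rightarrow> 'i \<Rightarrow> 'l \<Rightarrow> ('i + 'l) set \<Rightarrow> ('i + 'l) list \<Rightarrow> ('i \<times> 'g \<times> 'l) option list" where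
  "probe gs i l C xs = map (\<lambda>g. Some (i, g, l)) gs @
     map (\<lambda>x. if x \<in> C then Some (case x of Inl j \<Rightarrow> (j, \<one>, l) | Inr k \<Rightarrow> (i, \<one>, k)) else None) xs"

lemma probe_in_tuples:
  assumes "set gs = carrier G" "Inl i \<in> C" "Inr l \<in> C"
  shows "probe gs i l C xs \<in> tuples (rees_component G I \<Lambda> P C) (length gs + length xs)"
  using assms
  by (auto simp: tuples_def probe_def rees_component_eq_rees_semigroup rees_semigroup_def split: sum.splits)

text \<open>The first block of the probe supplies the normalization hypothesis of
  \<open>iso_normalized\<close>. Each later entry is either zero, which records that the vertex lies
  outside the component, or an outer factor from which that lemma reads off \<phi> and a trivial
  \<open>w\<close>. The hypothesis \<open>sides\<close> decides whether to read the left or the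
  right vertex.\<close>

lemma probe_iso_normalized:
  assumes gs: "set gs = carrier G"
    and C: "C \<in> rees_graph_components I \<Lambda> P" and D: "D \<in> rees_graph_components I \<Lambda> P"
    and f: "f \<in> semigroup_iso (rees_component G I \<Lambda> P C) (rees_component G I \<Lambda> P D)"
    and il: "Inl i \<in> C" "Inr l \<in> C" "P l i \<noteq> None"
    and sides: "map isl xs = map isl ys"
    and eq: "map f (probe gs i l C xs) = probe gs j k D ys"
  shows "\<exists>\<phi> w. normalized_iso G P P C D \<phi> w \<and> (\<forall>a<length xs. (xs ! a \<in> C \<longleftrightarrow> ys ! a \<in> D) \<and>
           (xs ! a \<in> C \<longrightarrow> \<phi> (xs ! a) = ys ! a \<and> w (xs ! a) = \<one>))"
proof -
  interpret C: rees_matrix G "Inl -` C" "Inr -` C" P by (rule component_rees_matrix[OF C])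
  interpret D: rees_matrix G "Inl -` D" "Inr -` D" P by (rule component_rees_matrix[OF D])
  have f': "f \<in> semigroup_iso (rees_semigroup G (Inl -` C) (Inr -` C) P) (rees_semigroup G (Inl -` D) (Inr -` D) P)"
    using f by (simp add: rees_component_eq_rees_semigroup)
  have len: "length xs = length ys" using sides by (metis length_map)
  have norm: "f (Some (i, g, l)) = Some (j, g, k)" if "g \<in> carrier G" for g
    using eq gs that by (auto simp: probe_def)
  have pos: "f (if xs ! a \<in> C then Some (case xs ! a of Inl j \<Rightarrow> (j, \<one>, l) | Inr k \<Rightarrow> (i, \<one>, k)) else None) =
      (if ys ! a \<in> D then Some (case ys ! a of Inl i \<Rightarrow> (i, \<one>, k) | Inr l \<Rightarrow> (j, \<one>, l)) else None)"
    if "a < length xs" for a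
    using arg_cong[OF eq, of "\<lambda>zs. zs ! (length gs + a)"] that len by (simp add: probe_def nth_append)
  have V: "Inl -` B <+> Inr -` B = B" for B :: "('i + 'l) set"
  proof (intro equalityI subsetI)
    show "x \<in> Inl -` B <+> Inr -` B" if "x \<in> B" for x using that by (cases x) auto
  qed auto
  obtain \<phi> w where n: "normalized_iso G P P (Inl -` C <+> Inr -` C) (Inl -` D <+> Inr -` D) \<phi> w"
    and L: "\<And>i' j'. i' \<in> Inl -` C \<Longrightarrow> f (Some (i', \<one>, l)) = Some (j', \<one>, k) \<Longrightarrow> \<phi> (Inl i') = Inl j' \<and> w (Inl i') = \<one>"
    and R: "\<And>l' k'. l' \<in> Inr -` C \<Longrightarrow> f (Some (i, \<one>, l')) = Some (j, \<one>, k') \<Longrightarrow> \<phi> (Inr l') = Inr k' \<and> w (Inr l') = \<one>"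
    by (rule C.iso_normalized[OF f' D.rees_matrix_axioms _ _ il(3) norm]) (use il in auto)
  \<comment> \<open>These maps serve to see that marked elements have nonzero images, so that
    \<open>ys ! a\<close> lies in \<open>D\<close> whenever \<open>xs ! a\<close> lies in
    \<open>C\<close>.\<close>
  obtain \<psi> \<chi> where
    fS: "\<And>i g l. i \<in> Inl -` C \<Longrightarrow> g \<in> carrier G \<Longrightarrow> l \<in> Inr -` C \<Longrightarrow>
        \<exists>h\<in>carrier G. f (Some (i, g, l)) = Some (\<psi> i, h, \<chi> l)"
    by (rule C.iso_vertex_maps[OF f']) blast
  have 0: "\<psi> i = j" "\<chi> l = k" using fS[of i \<one> l] norm[of \<one>] il by auto
  have "(xs ! a \<in> C \<longleftrightarrow> ys ! a \<in> D) \<and> (xs ! a \<in> C \<longrightarrow> \<phi> (xs ! a) = ys ! a \<and> w (xs ! a) = \<one>)"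
    if a: "a < length xs" for a
  proof (cases "xs ! a \<in> C")
    case False
    then show ?thesis using pos[OF a] C.iso_None[OF f'] by (simp split: if_splits)
  next
    case True
    have side: "isl (xs ! a) = isl (ys ! a)"
      using sides a len by (metis nth_map)
    show ?thesis
    proof (cases "xs ! a")
      case (Inl i')
      obtain h where h: "f (Some (i', \<one>, l)) = Some (\<psi> i', h, k)"
        using fS[of i' \<one> l] True Inl il 0 by auto
      then have D': "ys ! a \<in> D" using pos[OF a] True Inl by (simp split: if_splits)
      obtain j' where "ys ! a = Inl j'" using side Inl by (cases "ys ! a") auto
      then show ?thesis using L[of i' j'] pos[OF a] True D' Inl by simp
    next
      case (Inr l')
      obtain h where h: "f (Some (i, \<one>, l')) = Some (j, h, \<chi> l')"
        using fS[of i \<one> l'] True Inr il 0 by auto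
      then have D': "ys ! a \<in> D" using pos[OF a] True Inr by (simp split: if_splits)
      obtain k' where "ys ! a = Inr k'" using side Inr by (cases "ys ! a") auto
      then show ?thesis using R[of l' k'] pos[OF a] True D' Inr by simp
    qed
  qed
  then show ?thesis using n V by metis
qed

text \<open>Probes of different components are made comparable by carrying them along chosen
  isomorphisms to representatives of the isomorphism types. There are finitely many representatives,
  each with finitely many orbits on tuples of the required length.\<close>

lemma local_invariant:
  assumes fin: "finite (carrier G)"
    and cat: "\<And>C. C \<in> rees_graph_components I \<Lambda> P \<Longrightarrow> aleph0_categorical (rees_component G I \<Lambda> P C)"
    and many: "finitely_many_up_to_iso (connected_rees_components G I \<Lambda> P)"
  obtains loc :: "('i + 'l) set \<Rightarrow> ('i + 'l) list \<Rightarrow>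
      bool list \<times> ('i \<times> 'g \<times> 'l) option binary_structure \<times> ('i \<times> 'g \<times> 'l) option list set"
  where "\<And>n. finite {loc C xs | C xs. C \<in> rees_graph_components I \<Lambda> P \<and> length xs = n}"
    and "\<And>C D xs ys. C \<in> rees_graph_components I \<Lambda> P \<Longrightarrow> D \<in> rees_graph_components I \<Lambda> P \<Longrightarrow>
        loc C xs = loc D ys \<Longrightarrow>
        \<exists>\<phi> w. normalized_iso G P P C D \<phi> w \<and> (\<forall>a<length xs. (xs ! a \<in> C \<longleftrightarrow> ys ! a \<in> D) \<and>
           (xs ! a \<in> C \<longrightarrow> \<phi> (xs ! a) = ys ! a \<and> w (xs ! a) = \<one>))"
proof -
  let ?K = "rees_graph_components I \<Lambda> P" and ?T = "rees_component G I \<Lambda> P"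
    and ?Q = "connected_rees_components G I \<Lambda> P"
  obtain gs where gs: "set gs = carrier G" using finite_list[OF fin] by blast
  \<comment> \<open>The group has an identity, so probes are nonempty and the orbit bound applies
    even for \<open>n = 0\<close>.\<close>
  have len: "length gs + n \<ge> 1" for n using gs one_closed by (cases gs) auto
  define R where "R = {(S, T). S \<in> ?Q \<and> T \<in> ?Q \<and> isomorphic S T}"
  \<comment> \<open>The choice depends only on the class of the component, so only finitely many
    representatives occur.\<close>
  define r where "r C = (SOME T. T \<in> R `` {?T C})" for C
  have r: "r C \<in> ?Q" "isomorphic (?T C) (r C)" if "C \<in> ?K" for C
  proof -
    have "(?T C, ?T C) \<in> R"
      using that semigroup_iso_id by (fastforce simp: R_def connected_rees_components_def isomorphic_def)
    then have "r C \<in> R `` {?T C}" unfolding r_def by (intro someI[of "\<lambda>T. T \<in> R `` {?T C}"]) blast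
    then show "r C \<in> ?Q" "isomorphic (?T C) (r C)" by (auto simp: R_def)
  qed
  have "r ` ?K \<subseteq> (\<lambda>X. SOME T. T \<in> X) ` (?Q // R)"
  proof (rule image_subsetI)
    fix C assume "C \<in> ?K"
    then have "R `` {?T C} \<in> ?Q // R" by (intro quotientI) (auto simp: connected_rees_components_def)
    then show "r C \<in> (\<lambda>X. SOME T. T \<in> X) ` (?Q // R)" unfolding r_def by (rule imageI)
  qed
  then have finr: "finite (r ` ?K)"
    using many finite_subset unfolding finitely_many_up_to_iso_def R_def by blast
  have "\<forall>C\<in>?K. \<exists>h. h \<in> semigroup_iso (?T C) (r C)"
    using r(2) by (auto simp: isomorphic_def)
  then obtain h where h: "\<And>C. C \<in> ?K \<Longrightarrow> h C \<in> semigroup_iso (?T C) (r C)" by metis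
  obtain i l where il: "\<And>C. C \<in> ?K \<Longrightarrow> Inl (i C) \<in> C \<and> Inr (l C) \<in> C \<and> P (l C) (i C) \<noteq> None"
    using component_edge by metis
  define t where "t C xs = probe gs (i C) (l C) C xs" for C xs
  have t: "t C xs \<in> tuples (?T C) (length gs + length xs)" if "C \<in> ?K" for C xs
    using probe_in_tuples[OF gs] il[OF that] by (simp add: t_def)
  have ht: "map (h C) (t C xs) \<in> tuples (r C) (length gs + length xs)" if "C \<in> ?K" for C xs
    using t[OF that, of xs] semigroup_iso_closed[OF h[OF that]] by (auto simp: tuples_def)
  \<comment> \<open>Recording \<open>r C\<close> ensures that equal values compare orbits in the
    same semigroup; the sides of the vertices are not visible in the probe.\<close>
  define loc where "loc C xs = (map isl xs, r C,
      same_orbit (r C) (length gs + length xs) `` {map (h C) (t C xs)})" for C xs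
  show thesis
  proof
    fix n
    have "{loc C xs | C xs. C \<in> ?K \<and> length xs = n} \<subseteq> {bs. set bs \<subseteq> UNIV \<and> length bs = n} \<times>
      (SIGMA T:r ` ?K. tuples T (length gs + n) // same_orbit T (length gs + n))"
      using ht by (auto simp: loc_def quotientI)
    moreover have "finite (tuples T (length gs + n) // same_orbit T (length gs + n))" if "T \<in> r ` ?K" for T
    proof -
      have "T \<in> ?Q" using that r(1) by blast
      then have "aleph0_categorical T" using cat by (auto simp: connected_rees_components_def)
      then show ?thesis using len[of n] unfolding aleph0_categorical_def by blast
    qed
    ultimately show "finite {loc C xs | C xs. C \<in> ?K \<and> length xs = n}"
      using finr finite_lists_length_eq[of "UNIV :: bool set" n]
      by (auto elim!: finite_subset)
  next
    fix C D xs ys assume C: "C \<in> ?K" and D: "D \<in> ?K" and eq: "loc C xs = loc D ys"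
    then have sides: "map isl xs = map isl ys" and rr: "r C = r D" by (auto simp: loc_def)
    have "length xs = length ys" using sides by (metis length_map)
    then have "(map (h C) (t C xs), map (h D) (t D ys)) \<in> same_orbit (r D) (length gs + length ys)"
      using eq same_orbit_refl[OF ht[OF D, of ys]] by (auto simp: loc_def)
    then obtain a where a: "a \<in> semigroup_iso (r D) (r D)" "map (h D) (t D ys) = map a (map (h C) (t C xs))"
      by (auto simp: same_orbit_def)
    \<comment> \<open>Go to the common representative, apply its automorphism \<open>a\<close>, and
      return to the second component.\<close>
    define f where "f = inv_into (carrier (?T D)) (h D) \<circ> (a \<circ> h C)"
    have f: "f \<in> semigroup_iso (?T C) (?T D)"
      unfolding f_def
      using semigroup_iso_comp[OF semigroup_iso_comp[OF h[OF C, unfolded rr] a(1)]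
          semigroup_iso_inv_into[OF h[OF D] component_semigroup_closed[OF D]]] .
    have "map f (t C xs) = map (inv_into (carrier (?T D)) (h D)) (map (h D) (t D ys))"
      using a(2) by (simp add: f_def)
    also have "\<dots> = t D ys"
      using t[OF D, of ys] bij_betw_inv_into_left[OF semigroup_iso_bij[OF h[OF D]]]
      by (auto simp: tuples_def intro!: map_idI)
    finally show "\<exists>\<phi> w. normalized_iso G P P C D \<phi> w \<and> (\<forall>a<length xs. (xs ! a \<in> C \<longleftrightarrow> ys ! a \<in> D) \<and>
           (xs ! a \<in> C \<longrightarrow> \<phi> (xs ! a) = ys ! a \<and> w (xs ! a) = \<one>))"
      unfolding t_def using il[OF C] by (intro probe_iso_normalized[OF gs C D f _ _ _ sides]) auto
  qed
qed

text \<open>Equal keys match the components met by the two tuples, position by position. The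
  matching extends to a type-preserving permutation of all components, over which normalized
  isomorphisms are glued.\<close>

lemma vertex_tuple_invariant:
  assumes fin: "finite (carrier G)"
    and cat: "\<And>C. C \<in> rees_graph_components I \<Lambda> P \<Longrightarrow> aleph0_categorical (rees_component G I \<Lambda> P C)"
    and many: "finitely_many_up_to_iso (connected_rees_components G I \<Lambda> P)"
  obtains key :: "('i + 'l) list \<Rightarrow>
      (bool list \<times> ('i \<times> 'g \<times> 'l) option binary_structure \<times> ('i \<times> 'g \<times> 'l) option list set) list \<times>
      (bool list \<times> ('i \<times> 'g \<times> 'l) option binary_structure \<times> ('i \<times> 'g \<times> 'l) option list set) list"
  where "finite (key ` {xs. set xs \<subseteq> I <+> \<Lambda> \<and> length xs = n})"
    and "\<And>xs ys. set xs \<subseteq> I <+> \<Lambda> \<Longrightarrow> set ys \<subseteq> I <+> \<Lambda> \<Longrightarrow> key xs = key ys \<Longrightarrow>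
      \<exists>\<phi> w. normalized_iso G P P (I <+> \<Lambda>) (I <+> \<Lambda>) \<phi> w \<and> map \<phi> xs = ys \<and> (\<forall>x\<in>set xs. w x = \<one>)"
proof -
  let ?K = "rees_graph_components I \<Lambda> P" and ?V = "I <+> \<Lambda>"
  obtain loc :: "('i + 'l) set \<Rightarrow> ('i + 'l) list \<Rightarrow>
      bool list \<times> ('i \<times> 'g \<times> 'l) option binary_structure \<times> ('i \<times> 'g \<times> 'l) option list set"
    where locfin: "\<And>n. finite {loc C xs | C xs. C \<in> ?K \<and> length xs = n}"
    and loc: "\<And>C D xs ys. C \<in> ?K \<Longrightarrow> D \<in> ?K \<Longrightarrow> loc C xs = loc D ys \<Longrightarrow>
        \<exists>\<phi> w. normalized_iso G P P C D \<phi> w \<and> (\<forall>a<length xs. (xs ! a \<in> C \<longleftrightarrow> ys ! a \<in> D) \<and>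
           (xs ! a \<in> C \<longrightarrow> \<phi> (xs ! a) = ys ! a \<and> w (xs ! a) = \<one>))"
    by (rule local_invariant[OF assms]) (assumption, (rule that; assumption))
  obtain c where c: "\<And>x. x \<in> ?V \<Longrightarrow> c x \<in> ?K \<and> x \<in> c x"
    using component_exists by metis
  \<comment> \<open>The first list describes how the whole tuple sits relative to the component of
    each entry. The second records the bare type \<open>loc C []\<close> of that component, which is
    also defined for components that the tuple misses.\<close>
  define key where "key xs = (map (\<lambda>x. loc (c x) xs) xs, map (\<lambda>x. loc (c x) []) xs)" for xs
  show thesis
  proof (rule that[of key])
    let ?A = "\<lambda>n. {loc C xs | C xs. C \<in> ?K \<and> length xs = n}"
    have "key ` {xs. set xs \<subseteq> ?V \<and> length xs = n} \<subseteq>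
        {us. set us \<subseteq> ?A n \<and> length us = n} \<times> {us. set us \<subseteq> ?A 0 \<and> length us = n}"
    proof (rule image_subsetI)
      fix xs assume "xs \<in> {xs. set xs \<subseteq> ?V \<and> length xs = n}"
      then have xs: "set xs \<subseteq> ?V" "length xs = n" by auto
      have "loc (c x) xs \<in> ?A n \<and> loc (c x) [] \<in> ?A 0" if "x \<in> set xs" for x
      proof -
        have "c x \<in> ?K" using that c xs(1) by (metis subsetD)
        then show ?thesis using xs(2) by fastforce
      qed
      then show "key xs \<in> {us. set us \<subseteq> ?A n \<and> length us = n} \<times> {us. set us \<subseteq> ?A 0 \<and> length us = n}"
        using xs(2) unfolding key_def by (simp only: mem_Times_iff) (simp add: image_subset_iff)
    qed
    then show "finite (key ` {xs. set xs \<subseteq> ?V \<and> length xs = n})"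
      using locfin by (elim finite_subset) (intro finite_cartesian_product finite_lists_length_eq)
  next
    fix xs ys assume xs: "set xs \<subseteq> ?V" and ys: "set ys \<subseteq> ?V" and eq: "key xs = key ys"
    have len: "length xs = length ys"
      using arg_cong[OF eq, of "\<lambda>k. length (fst k)"] by (simp add: key_def)
    let ?n = "length xs"
    have cx: "c (xs ! a) \<in> ?K" "xs ! a \<in> c (xs ! a)" "c (ys ! a) \<in> ?K" "ys ! a \<in> c (ys ! a)"
      if "a < ?n" for a
      using that c xs ys len nth_mem by (metis subsetD)+
    have l1: "loc (c (xs ! a)) xs = loc (c (ys ! a)) ys" and l0: "loc (c (xs ! a)) [] = loc (c (ys ! a)) []"
      if "a < ?n" for a
      using that eq len by (auto simp: key_def list_eq_iff_nth_eq)
    \<comment> \<open>Each local invariant sees the whole tuple and marks entries outside its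
      component, so it detects which entries share a component.\<close>
    have pat: "c (xs ! a) = c (xs ! b) \<longleftrightarrow> c (ys ! a) = c (ys ! b)" if a: "a < ?n" and b: "b < ?n" for a b
    proof -
      have "xs ! b \<in> c (xs ! a) \<longleftrightarrow> ys ! b \<in> c (ys ! a)"
        using loc[OF cx(1,3)[OF a] l1[OF a]] b by blast
      then show ?thesis using cx[OF a] cx[OF b] component_unique by metis
    qed
    define A where "A = (\<lambda>a. c (xs ! a)) ` {..<?n}"
    \<comment> \<open>A component may be met at several positions; by \<open>pat\<close> the choice
      does not affect \<open>s\<close>, and \<open>s\<close> is injective.\<close>
    define pos where "pos C = (SOME a. a < ?n \<and> c (xs ! a) = C)" for C
    define s where "s C = c (ys ! pos C)" for C
    have pos: "pos C < ?n \<and> c (xs ! pos C) = C" if "C \<in> A" for C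
      unfolding pos_def by (rule someI_ex) (use that in \<open>auto simp: A_def\<close>)
    have s: "s (c (xs ! a)) = c (ys ! a)" if "a < ?n" for a
      using pos[of "c (xs ! a)"] pat that unfolding s_def A_def by blast
    have "\<exists>p. bij_betw p ?K ?K \<and> (\<forall>C\<in>A. p C = s C) \<and> (\<forall>C\<in>?K. loc (p C) [] = loc C [])"
    proof (rule extend_finite_injection)
      show "inj_on s A" using pat by (auto simp: inj_on_def A_def s)
    qed (use cx l0 in \<open>auto simp: A_def s\<close>)
    then obtain p where p: "bij_betw p ?K ?K" "\<And>C. C \<in> A \<Longrightarrow> p C = s C"
      "\<And>C. C \<in> ?K \<Longrightarrow> loc (p C) [] = loc C []" by blast
    have "\<exists>\<phi> w. normalized_iso G P P C (p C) \<phi> w \<and>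
        (\<forall>a<?n. xs ! a \<in> C \<longrightarrow> \<phi> (xs ! a) = ys ! a \<and> w (xs ! a) = \<one>)" if C: "C \<in> ?K" for C
    proof (cases "C \<in> A")
      case True
      then obtain a where a: "a < ?n" "C = c (xs ! a)" by (auto simp: A_def)
      then have "p C = c (ys ! a)" using p(2)[OF True] s by simp
      then show ?thesis using loc[OF cx(1,3)[OF a(1)] l1[OF a(1)]] a by auto
    next
      case False
      \<comment> \<open>For a component missed by \<open>xs\<close> any normalized isomorphism will
        do, and equality of the types for the empty tuple provides one.\<close>
      have "p C \<in> ?K" using p(1) C by (simp add: bij_betw_apply)
      then obtain \<phi> w where "normalized_iso G P P C (p C) \<phi> w"
        using loc[OF C _ p(3)[OF C, symmetric]] by blast
      moreover have "xs ! a \<notin> C" if "a < ?n" for a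
        using False component_unique[OF C cx(1)[OF that] _ cx(2)[OF that]] that by (auto simp: A_def)
      ultimately show ?thesis by blast
    qed
    then obtain \<phi> w where n: "\<And>C. C \<in> ?K \<Longrightarrow> normalized_iso G P P C (p C) (\<phi> C) (w C)"
      and v: "\<And>C a. C \<in> ?K \<Longrightarrow> a < ?n \<Longrightarrow> xs ! a \<in> C \<Longrightarrow> \<phi> C (xs ! a) = ys ! a \<and> w C (xs ! a) = \<one>"
      by metis
    have "normalized_iso G P P ?V ?V (\<lambda>x. \<phi> (c x) x) (\<lambda>x. w (c x) x)"
      by (rule glue_normalized_isos[OF p(1) n c])
    moreover have "map (\<lambda>x. \<phi> (c x) x) xs = ys"
      using len v cx by (auto simp: list_eq_iff_nth_eq)
    moreover have "\<forall>x\<in>set xs. w (c x) x = \<one>"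
      using v cx by (auto simp: in_set_conv_nth)
    ultimately show "\<exists>\<phi> w. normalized_iso G P P ?V ?V \<phi> w \<and> map \<phi> xs = ys \<and> (\<forall>x\<in>set xs. w x = \<one>)"
      by (intro exI[of _ "\<lambda>x. \<phi> (c x) x"] exI[of _ "\<lambda>x. w (c x) x"]) blast
  qed
qed

text \<open>An \<open>n\<close>-tuple is encoded by \<open>2 * n\<close> vertices and
  \<open>n\<close> group coordinates, the latter with finitely many possibilities because the group
  is finite. Trivial \<open>w\<close> at the vertices involved means that the induced automorphism
  leaves these coordinates unchanged.\<close>

lemma components_categorical_imp_categorical:
  assumes count: "countable (carrier (rees_semigroup G I \<Lambda> P))"
    and fin: "finite (carrier G)"
    and cat: "\<And>C. C \<in> rees_graph_components I \<Lambda> P \<Longrightarrow> aleph0_categorical (rees_component G I \<Lambda> P C)"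
    and many: "finitely_many_up_to_iso (connected_rees_components G I \<Lambda> P)"
  shows "aleph0_categorical (rees_semigroup G I \<Lambda> P)"
proof -
  let ?S = "rees_semigroup G I \<Lambda> P" and ?V = "I <+> \<Lambda>"
  obtain i0 l0 where 0: "i0 \<in> I" "l0 \<in> \<Lambda>" using I_nonempty \<Lambda>_nonempty by blast
  \<comment> \<open>Zero receives the default vertices \<open>Inl i0\<close> and
    \<open>Inr l0\<close>, which keeps the number of vertices at \<open>2 * n\<close>; the value
    \<open>None\<close> of \<open>gv\<close> tells it apart from nonzero elements.\<close>
  define lv where "lv x = (case x of None \<Rightarrow> (Inl i0 :: 'i + 'l) | Some (i, g, l) \<Rightarrow> Inl i)" for x :: "('i \<times> 'g \<times> 'l) option"
  define rv where "rv x = (case x of None \<Rightarrow> (Inr l0 :: 'i + 'l) | Some (i, g, l) \<Rightarrow> Inr l)" for x :: "('i \<times> 'g \<times> 'l) option"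
  define gv where "gv = map_option (\<lambda>(i :: 'i, g :: 'g, l :: 'l). g)"
  define vs where "vs xs = map lv xs @ map rv xs" for xs
  have vs: "set (vs xs) \<subseteq> ?V \<and> length (vs xs) = 2 * n" if "xs \<in> tuples ?S n" for xs n
    using that 0 by (fastforce simp: vs_def tuples_def lv_def rv_def rees_semigroup_def split: option.splits)
  have "finite (tuples ?S n // same_orbit ?S n)" for n
  proof -
    obtain key :: "('i + 'l) list \<Rightarrow>
      (bool list \<times> ('i \<times> 'g \<times> 'l) option binary_structure \<times> ('i \<times> 'g \<times> 'l) option list set) list \<times>
      (bool list \<times> ('i \<times> 'g \<times> 'l) option binary_structure \<times> ('i \<times> 'g \<times> 'l) option list set) list"
      where keyfin: "finite (key ` {xs. set xs \<subseteq> ?V \<and> length xs = 2 * n})"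
      and key: "\<And>xs ys. set xs \<subseteq> ?V \<Longrightarrow> set ys \<subseteq> ?V \<Longrightarrow> key xs = key ys \<Longrightarrow>
        \<exists>\<phi> w. normalized_iso G P P ?V ?V \<phi> w \<and> map \<phi> xs = ys \<and> (\<forall>x\<in>set xs. w x = \<one>)"
      by (rule vertex_tuple_invariant[OF fin cat many, of "2 * n"]) (assumption, (rule that; assumption))
    let ?h = "\<lambda>xs. (key (vs xs), map gv xs)"
    show ?thesis
    proof (rule finite_quotient_by_invariant)
      show "equiv (tuples ?S n) (same_orbit ?S n)" by (rule equiv_same_orbit[OF rees_closed])
      have "?h ` tuples ?S n \<subseteq> key ` {xs. set xs \<subseteq> ?V \<and> length xs = 2 * n} \<times>
          {gs. set gs \<subseteq> insert None (Some ` carrier G) \<and> length gs = n}"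
        using vs by (fastforce simp: tuples_def gv_def rees_semigroup_def)
      then show "finite (?h ` tuples ?S n)"
        using keyfin fin by (elim finite_subset) (intro finite_cartesian_product finite_lists_length_eq, auto)
    next
      fix xs ys assume xs: "xs \<in> tuples ?S n" and ys: "ys \<in> tuples ?S n" and eq: "?h xs = ?h ys"
      then obtain \<phi> w where n: "normalized_iso G P P ?V ?V \<phi> w" and m: "map \<phi> (vs xs) = vs ys"
        and w: "\<forall>x\<in>set (vs xs). w x = \<one>"
        using key[of "vs xs" "vs ys"] vs by auto
      define F where "F = map_option (\<lambda>(i, g, l).
        (projl (\<phi> (Inl i)), w (Inl i) \<otimes> g \<otimes> w (Inr l), projr (\<phi> (Inr l))))"
      have F: "F \<in> semigroup_iso ?S ?S"
        unfolding F_def by (rule normalized_iso_induces_iso[OF n])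
      have len: "length xs = n" "length ys = n" using xs ys by (auto simp: tuples_def)
      have "F (xs ! a) = ys ! a" if a: "a < n" for a
      proof -
        have g: "gv (xs ! a) = gv (ys ! a)"
          using eq a len by (auto simp: list_eq_iff_nth_eq)
        have "map (\<phi> \<circ> lv) xs = map lv ys" "map (\<phi> \<circ> rv) xs = map rv ys"
          using m len by (auto simp: vs_def)
        then have "\<phi> (lv (xs ! a)) = lv (ys ! a)" "\<phi> (rv (xs ! a)) = rv (ys ! a)"
          using a len by (auto simp: list_eq_iff_nth_eq)
        moreover have "w (lv (xs ! a)) = \<one>" "w (rv (xs ! a)) = \<one>"
          using w a len by (auto simp: vs_def)
        moreover have "xs ! a \<in> carrier ?S"
          using xs a len by (auto simp: tuples_def)
        ultimately show ?thesis
          using g by (cases "xs ! a"; cases "ys ! a")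
            (auto simp: F_def gv_def lv_def rv_def rees_semigroup_def)
      qed
      then have "map F xs = ys" using len by (simp add: list_eq_iff_nth_eq)
      then show "(xs, ys) \<in> same_orbit ?S n"
        using F xs ys by (auto simp: same_orbit_def)
    qed
  qed
  then show ?thesis using count by (simp add: aleph0_categorical_def)
qed

end

theorem theorem5p15:
  fixes G :: "('g, 'm) monoid_scheme"
    and I :: "'i set" and \<Lambda> :: "'l set" and P :: "'l \<Rightarrow> 'i \<Rightarrow> 'g option"
  assumes "rees_matrix G I \<Lambda> P"
    and "countable (carrier (rees_semigroup G I \<Lambda> P))"
    and "finite (carrier G)"
  shows "aleph0_categorical (rees_semigroup G I \<Lambda> P) \<longleftrightarrow>
    (\<forall>T\<in>connected_rees_components G I \<Lambda> P. aleph0_categorical T) \<and>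
    finitely_many_up_to_iso (connected_rees_components G I \<Lambda> P)"
proof -
  interpret rees_matrix G I \<Lambda> P by (rule assms(1))
  show ?thesis
    using categorical_imp_component_categorical categorical_imp_finitely_many
      components_categorical_imp_categorical[OF assms(2,3)]
    by (auto simp: connected_rees_components_def)
qed

end
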